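(* There exists an absolute constant $c>0$ (independent of $n$ and $N$) with the following property. For every $n\in\mathbb N$ and every extremal function $f$ for $M_n$, the number $N$ of atoms of $f$ satisfies $N\geq cn$.
   Context: $\mathbb D$ is the open unit disc. $\mathcal B_0=\{f \text{ holomorphic on }\mathbb D : 0<|f(z)|\le 1 \text{ for all } z\in\mathbb D\}$. For $f(z)=\sum_{j\ge0}a_jz^j$ and $n\in\mathbb N$, $M_n(f)=\mathrm{Re}\,a_n$. A function $f\in\mathcal B_0$ is extremal for $M_n$ if $M_n(f)\ge M_n(F)$ for all $F\in\mathcal B_0$. It is known that every extremal function $f$ for $M_n$ can be written as $f(z)=\gamma\exp\big(-\sum_{j=1}^N\lambda_j\frac{1+\alpha_jz}{1-\alpha_jz}\big)$ with $\gamma\in\partial\mathbb D$ (and $\gamma=1$ if $f(0)>0$), an integer $1\le N\le n$, weights $\lambda_1,\dots,\lambda_N>0$ and distinct points $\alpha_1,\dots,\alpha_N\in\partial\mathbb D$; $N$ is called the number of atoms of $f$. *)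

theory Defs
  imports "HOL-Complex_Analysis.Complex_Analysis"
begin

definition B0 :: "(complex \<Rightarrow> complex) set" where
  "B0 = {f. f holomorphic_on ball 0 1 \<and> (\<forall>z\<in>ball 0 1. 0 < norm (f z) \<and> norm (f z) \<le> 1)}"

definition Mfun :: "nat \<Rightarrow> (complex \<Rightarrow> complex) \<Rightarrow> real" where
  "Mfun n f = Re ((deriv ^^ n) f 0 / of_nat (fact n))"

definition extremal :: "nat \<Rightarrow> (complex \<Rightarrow> complex) \<Rightarrow> bool" where
  "extremal n f \<longleftrightarrow> f \<in> B0 \<and> (\<forall>F\<in>B0. Mfun n F \<le> Mfun n f)"

definition atom_repr ::
  "(complex \<Rightarrow> complex) \<Rightarrow> nat \<Rightarrow> complex \<Rightarrow> (nat \<Rightarrow> real) \<Rightarrow> (nat \<Rightarrow> complex) \<Rightarrow> bool" where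
  "atom_repr f N \<gamma> lam al \<longleftrightarrow>
     1 \<le> N \<and> norm \<gamma> = 1 \<and> (\<forall>j<N. 0 < lam j \<and> norm (al j) = 1) \<and> inj_on al {..<N} \<and>
     (\<forall>z\<in>ball 0 1. f z = \<gamma> * exp (- (\<Sum>j<N. of_real (lam j) * (1 + al j * z) / (1 - al j * z))))"

end

theory Submission
  imports Defs "HOL-Computational_Algebra.Fundamental_Theorem_Algebra"
begin

text \<open>Write \<open>f = \<gamma> exp (- p)\<close>, let \<open>\<omega>(t) = \<Sum>j<N. 2 \<lambda>\<^sub>j / |e\<^sup>i\<^sup>t - \<alpha>\<^sub>j|\<^sup>2\<close>, and let
  \<open>Q(t) = T(t) + i q(t)\<close> be the \<open>n\<close>-th coefficient of \<open>f\<close> times the Herglotz kernel with parameter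
  \<open>e\<^sup>i\<^sup>t\<close>. The first variation gives \<open>T \<ge> 0\<close>, with (double) zeros at the atoms, and comparing
  coefficients in \<open>f' = - p' f\<close> turns this into the identity \<open>q' = T (n - \<omega>)\<close>.

  Put \<open>X = (\<omega> - n) / (\<omega> + n)\<close>, which extends continuously by 1 to the atoms. Integrating
  \<open>(arctan q)' X\<close> by parts, and using that the total variation of \<open>X\<close> is at most the sum of the
  variations belonging to the single atoms, one gets
  \<open>\<integral> T (\<omega> - n)\<^sup>2 / ((\<omega> + n) (1 + q\<^sup>2)) = O(N)\<close>.
  If \<open>\<omega>\<close> is not too close to \<open>n\<close> on most of the circle, the left-hand side is at least a constant times
  \<open>n\<close>, because \<open>T\<close> has mean \<open>a\<^sub>n \<ge> 1/2\<close> while \<open>T\<close> and \<open>q\<close> are bounded in \<open>L\<^sup>2\<close>.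

  That \<open>\<omega> \<approx> n\<close> only on a small set \<open>G\<close> holds for every choice of atoms. Moving each pole of the analytic
  function with boundary values \<open>\<omega>\<close> off the disc by a small multiple of its distance to \<open>G\<close>
  yields an analytic \<open>V\<close> in the closed disc which is still close to \<open>n\<close> on \<open>G\<close>, is \<open>O(n)\<close> on the whole
  circle, and vanishes at 0; Jensen's inequality for \<open>V / n - 1\<close> bounds the measure of \<open>G\<close>.\<close>


subsection \<open>Jensen's inequality\<close>

lemma circle_mean:
  assumes "g holomorphic_on cball 0 r" "0 < r"
  shows "((\<lambda>t. g (of_real r * cis t)) has_integral 2 * of_real pi * g 0) {0..2*pi}"
proof -
  have "((\<lambda>u. g u / (u - 0)) has_contour_integral (2 * of_real pi * \<i> * g 0)) (circlepath 0 r)"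
    using assms by (intro Cauchy_integral_circlepath_simple) auto
  hence "((\<lambda>t. g (of_real r * cis t) / (of_real r * cis t) * r * \<i> * cis t)
            has_integral (2 * of_real pi * \<i> * g 0)) {0..2*pi}"
    unfolding circlepath_def by (subst (asm) has_contour_integral_part_circlepath_iff) simp_all
  hence "((\<lambda>t. \<i> * g (of_real r * cis t)) has_integral (\<i> * (2 * of_real pi * g 0))) {0..2*pi}"
    using assms(2) by (simp add: mult_ac cis_neq_zero)
  hence "((\<lambda>t. -\<i> * (\<i> * g (of_real r * cis t))) has_integral (-\<i> * (\<i> * (2 * of_real pi * g 0)))) {0..2*pi}"
    by (rule has_integral_mult_right)
  thus ?thesis by simp
qed

text \<open>On the closed disc \<open>1 - u * z\<close> stays in the right half-plane, so its
  principal logarithm is holomorphic there, and the mean value property returns its value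
  \<open>Ln 1 = 0\<close> at the centre.\<close>

lemma mean_ln_norm_one_minus:
  fixes u :: complex
  assumes "norm u < 1"
  shows "((\<lambda>t. ln (norm (1 - u * cis t))) has_integral 0) {0..2*pi}"
proof -
  have pos: "1 - u * z \<notin> \<real>\<^sub>\<le>\<^sub>0" "1 - u * z \<noteq> 0" if "norm z \<le> 1" for z
  proof -
    have "norm (u * z) < 1"
      using assms that by (metis mult_le_one mult_left_le norm_ge_zero norm_mult order_le_less_trans)
    hence "Re (u * z) < 1" using complex_Re_le_cmod[of "u * z"] by linarith
    thus "1 - u * z \<notin> \<real>\<^sub>\<le>\<^sub>0" "1 - u * z \<noteq> 0"
      by (auto simp: complex_nonpos_Reals_iff complex_eq_iff)
  qed
  have "((\<lambda>t. Ln (1 - u * (of_real 1 * cis t))) has_integral 2 * of_real pi * Ln (1 - u * 0)) {0..2*pi}"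
    by (rule circle_mean) (auto intro!: holomorphic_intros simp: pos)
  from has_integral_linear[OF this bounded_linear_Re]
  have "((\<lambda>t. Re (Ln (1 - u * cis t))) has_integral 0) {0..2*pi}"
    by (simp add: o_def)
  moreover have "Re (Ln (1 - u * cis t)) = ln (norm (1 - u * cis t))" for t
    using pos(2)[of "cis t"] by simp
  ultimately show ?thesis by simp
qed

text \<open>A root inside the disc can be reflected to \<open>1 - cnj \<rho> * z\<close> and has
  logarithmic mean 0, which exceeds \<open>ln (norm \<rho>)\<close>; for a root outside, factoring
  out \<open>- \<rho>\<close> gives equality.\<close>

lemma mean_ln_norm_root:
  fixes \<rho> :: complex
  assumes "\<rho> \<noteq> 0" "norm \<rho> \<noteq> 1"
  shows "2 * pi * ln (norm \<rho>) \<le> integral {0..2*pi} (\<lambda>t. ln (norm (cis t - \<rho>)))"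
proof (cases "norm \<rho> < 1")
  case True
  have "norm (cis t - \<rho>) = norm (1 - cnj \<rho> * cis t)" for t
  proof -
    have "norm (cis t - \<rho>) = norm (cnj (cis t - \<rho>)) * norm (cis t)" by (simp only: complex_mod_cnj norm_cis mult_1_right)
    also have "\<dots> = norm ((cnj (cis t) - cnj \<rho>) * cis t)" by (simp add: norm_mult)
    also have "(cnj (cis t) - cnj \<rho>) * cis t = 1 - cnj \<rho> * cis t"
      by (simp add: algebra_simps cis_cnj cis_mult)
    finally show ?thesis .
  qed
  hence "((\<lambda>t. ln (norm (cis t - \<rho>))) has_integral 0) {0..2*pi}"
    using mean_ln_norm_one_minus[of "cnj \<rho>"] True by simp
  moreover have "ln (norm \<rho>) \<le> 0" using True assms by simp
  ultimately show ?thesis by (simp add: integral_unique mult_nonneg_nonpos)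
next
  case False
  hence gt: "norm \<rho> > 1" using assms by simp
  have eq: "ln (norm (cis t - \<rho>)) = ln (norm (1 - inverse \<rho> * cis t)) + ln (norm \<rho>)" for t
  proof -
    have "cis t - \<rho> = - \<rho> * (1 - inverse \<rho> * cis t)" using assms by (simp add: algebra_simps)
    hence "norm (cis t - \<rho>) = norm \<rho> * norm (1 - inverse \<rho> * cis t)" by (simp only: norm_mult norm_minus_cancel)
    moreover have "cis t \<noteq> \<rho>" using gt by auto
    hence "norm (1 - inverse \<rho> * cis t) > 0" using assms by (auto simp: field_simps)
    ultimately show ?thesis using assms by (simp add: ln_mult)
  qed
  have "((\<lambda>t. ln (norm (cis t - \<rho>))) has_integral 0 + ln (norm \<rho>) * (2*pi)) {0..2*pi}"
    unfolding eq using gt has_integral_const_real[of "ln (norm \<rho>)" 0 "2*pi"]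
    by (intro has_integral_add mean_ln_norm_one_minus) (auto simp: norm_inverse inverse_less_1_iff mult_ac)
  thus ?thesis by (simp add: integral_unique)
qed

lemma ln_norm_continuous_circle:
  assumes "continuous_on (sphere 0 1) g" "\<And>z. norm z = 1 \<Longrightarrow> g z \<noteq> (0::complex)"
  shows "continuous_on {0..2*pi} (\<lambda>t. ln (norm (g (cis t))))"
proof -
  have c: "continuous_on {0..2*pi} (\<lambda>t. g (cis t))"
    by (rule continuous_on_compose2[OF assms(1) continuous_on_cis[OF continuous_on_id]]) auto
  show ?thesis
    by (rule continuous_on_ln[OF continuous_on_norm[OF c]]) (simp add: assms(2))
qed

text \<open>The logarithm makes both sides additive over factors, so linear factors are split off
  one at a time. Excluding roots on the circle keeps every integrand continuous.\<close>

lemma jensen_poly: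
  fixes p :: "complex poly"
  assumes "poly p 0 \<noteq> 0" "\<And>z. norm z = 1 \<Longrightarrow> poly p z \<noteq> 0"
  shows "2 * pi * ln (norm (poly p 0)) \<le> integral {0..2*pi} (\<lambda>t. ln (norm (poly p (cis t))))"
  using assms
proof (induction "degree p" arbitrary: p)
  case 0
  then obtain c where "p = [:c:]" by (metis degree_eq_zeroE)
  thus ?case by simp
next
  case (Suc d)
  have "\<not> constant (poly p)" using Suc.hyps(2) by (simp add: constant_degree)
  then obtain \<rho> where "poly p \<rho> = 0" using fundamental_theorem_of_algebra by blast
  then obtain q where q: "p = [:-\<rho>, 1:] * q" by (metis dvdE poly_eq_0_iff_dvd)
  have nz: "\<rho> \<noteq> 0" "norm \<rho> \<noteq> 1" "poly q 0 \<noteq> 0" and qz: "\<And>z. norm z = 1 \<Longrightarrow> poly q z \<noteq> 0"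
    using Suc.prems \<open>poly p \<rho> = 0\<close> by (auto simp: q)
  have "q \<noteq> 0" using nz by auto
  hence "degree p = 1 + degree q" unfolding q by (subst degree_mult_eq) auto
  hence IH: "2 * pi * ln (norm (poly q 0)) \<le> integral {0..2*pi} (\<lambda>t. ln (norm (poly q (cis t))))"
    using Suc nz qz by simp
  have ne: "cis t \<noteq> \<rho>" "poly q (cis t) \<noteq> 0" for t using nz(2) qz[of "cis t"] by auto
  have "continuous_on {0..2*pi} (\<lambda>t. ln (norm (cis t - \<rho>)))"
    by (rule ln_norm_continuous_circle[of "\<lambda>z. z - \<rho>"]) (intro continuous_intros, use nz(2) in force)
  hence i1: "(\<lambda>t. ln (norm (cis t - \<rho>))) integrable_on {0..2*pi}"
    by (rule integrable_continuous_interval)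
  have "continuous_on {0..2*pi} (\<lambda>t. ln (norm (poly q (cis t))))"
    by (rule ln_norm_continuous_circle[of "poly q"]) (intro continuous_intros, use qz in force)
  hence i2: "(\<lambda>t. ln (norm (poly q (cis t)))) integrable_on {0..2*pi}"
    by (rule integrable_continuous_interval)
  have "ln (norm (poly p 0)) = ln (norm \<rho>) + ln (norm (poly q 0))"
    using nz by (simp add: q norm_mult ln_mult)
  moreover have "ln (norm (poly p (cis t))) = ln (norm (cis t - \<rho>)) + ln (norm (poly q (cis t)))" for t
  proof -
    have "poly p (cis t) = (cis t - \<rho>) * poly q (cis t)" by (simp add: q algebra_simps)
    thus ?thesis using ne[of t] by (simp only: norm_mult) (simp add: ln_mult)
  qed
  ultimately show ?case
    using mean_ln_norm_root[OF nz(1,2)] IH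
    by (simp only: integral_add[OF i1 i2] distrib_left)
qed

section \<open>From polynomials to holomorphic functions, with a truncated logarithm\<close>

lemma holomorphic_poly_approx_cball:
  assumes "X holomorphic_on ball 0 R" "1 < R" "0 < \<eta>"
  obtains p where "poly p 0 = X 0" "\<And>z. norm z \<le> 1 \<Longrightarrow> norm (X z - poly p z) < \<eta>"
proof -
  define a where "a i = (deriv ^^ i) X 0 / fact i" for i
  have sums: "(\<lambda>i. a i * z ^ i) sums X z" if "norm z < R" for z
    using holomorphic_power_series[OF assms(1), of z] that unfolding a_def by simp
  \<comment> \<open>A modulus strictly between 1 and \<open>R\<close> pushes the radius of
    convergence above 1, so that the Taylor sums converge uniformly on the closed disc.\<close>
  define w :: complex where "w = of_real ((1 + R) / 2)"
  have w: "norm w = (1 + R) / 2" using assms(2) unfolding w_def norm_of_real by simp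
  have "summable (\<lambda>i. a i * w ^ i)" using sums[of w] assms(2) w by (intro sums_summable) simp
  hence "ereal (norm w) \<le> conv_radius a" by (rule conv_radius_geI)
  moreover have "ereal 1 < ereal (norm w)" using assms(2) w by simp
  ultimately have "ereal 1 < conv_radius a" by (rule order_less_le_trans[rotated])
  hence "uniform_limit (cball 0 1) (\<lambda>n x. \<Sum>i<n. a i * (x - 0) ^ i) (\<lambda>x. suminf (\<lambda>i. a i * (x - 0) ^ i)) sequentially"
    by (rule powser_uniform_limit)
  hence "\<forall>\<^sub>F n in sequentially. \<forall>x\<in>cball 0 1. dist (\<Sum>i<n. a i * x ^ i) (suminf (\<lambda>i. a i * x ^ i)) < \<eta>"
    using assms(3) unfolding uniform_limit_iff by simp
  \<comment> \<open>A non-empty partial sum contains the constant term, so the value at 0 is kept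
    exactly.\<close>
  moreover have "\<forall>\<^sub>F n in sequentially. n > (0::nat)" by (rule eventually_gt_at_top)
  ultimately have "\<forall>\<^sub>F n in sequentially. n > 0 \<and> (\<forall>x\<in>cball 0 1. dist (\<Sum>i<n. a i * x ^ i) (suminf (\<lambda>i. a i * x ^ i)) < \<eta>)"
    by eventually_elim simp
  then obtain n where n: "n > 0"
      "\<And>x. x \<in> cball 0 1 \<Longrightarrow> dist (\<Sum>i<n. a i * x ^ i) (suminf (\<lambda>i. a i * x ^ i)) < \<eta>"
    using eventually_happens'[OF sequentially_bot] by blast
  define p where "p = (\<Sum>i<n. monom (a i) i)"
  have p: "poly p z = (\<Sum>i<n. a i * z ^ i)" for z by (simp add: p_def poly_sum poly_monom)
  show ?thesis
  proof
    have "{..<n} = insert 0 {1..<n}" using n(1) by auto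
    hence "poly p 0 = a 0" unfolding p by (simp add: power_0_left)
    thus "poly p 0 = X 0" by (simp add: a_def)
    fix z :: complex assume z: "norm z \<le> 1"
    have "suminf (\<lambda>i. a i * z ^ i) = X z" using sums[of z] z assms(2) by (simp add: sums_iff)
    thus "norm (X z - poly p z) < \<eta>" using n(2)[of z] z by (simp add: p dist_norm norm_minus_commute)
  qed
qed

text \<open>The roots have only finitely many moduli, so a contraction of the variable by a suitable
  factor \<open>r < 1\<close> close to 1 moves all of them off the circle and fixes the value at
  0.\<close>

lemma poly_approx_no_roots_on_circle:
  fixes p :: "complex poly"
  assumes "poly p 0 \<noteq> 0" "0 < \<eta>"
  obtains q where "poly q 0 = poly p 0" "\<And>z. norm z = 1 \<Longrightarrow> poly q z \<noteq> 0"
    "\<And>z. norm z = 1 \<Longrightarrow> norm (poly p z - poly q z) < \<eta>"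
proof -
  have "uniformly_continuous_on (cball 0 1) (poly p)"
    by (intro compact_uniformly_continuous continuous_intros compact_cball)
  then obtain d where d: "d > 0"
      "\<And>x y. x \<in> cball 0 1 \<Longrightarrow> y \<in> cball 0 1 \<Longrightarrow> dist y x < d \<Longrightarrow> dist (poly p y) (poly p x) < \<eta>"
    using assms(2) unfolding uniformly_continuous_on_def by metis
  have "finite (norm ` {x. poly p x = 0})" using assms(1) poly_roots_finite[of p] by fastforce
  moreover have "infinite {max 0 (1 - d)<..<1}" using d(1) by (intro infinite_Ioo) auto
  ultimately obtain r where r: "r \<in> {max 0 (1 - d)<..<1}" "r \<notin> norm ` {x. poly p x = 0}"
    by (meson finite_subset subsetI)
  define q where "q = pcompose p [:0, of_real r:]"
  have q: "poly q z = poly p (of_real r * z)" for z by (simp add: q_def poly_pcompose mult.commute)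
  show ?thesis
  proof
    show "poly q 0 = poly p 0" by (simp add: q)
    fix z :: complex assume z: "norm z = 1"
    have "norm (of_real r * z) = r" using z r(1) by (simp add: norm_mult)
    thus "poly q z \<noteq> 0" using r(2) unfolding q by (metis (mono_tags) imageI mem_Collect_eq)
    have "dist (of_real r * z) z = norm (of_real (r - 1) * z)" by (simp add: dist_norm algebra_simps)
    also have "\<dots> = 1 - r" using z r(1) by (simp add: norm_mult del: of_real_diff)
    finally have "dist (of_real r * z) z < d" using r(1) by simp
    moreover have "z \<in> cball 0 1" "of_real r * z \<in> cball 0 1" using z r(1) by (auto simp: norm_mult)
    ultimately show "norm (poly p z - poly q z) < \<eta>"
      using d(2) unfolding q by (metis dist_norm norm_minus_commute)
  qed
qed

text \<open>Truncation from below at \<delta> makes the logarithm Lipschitz with constant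
  \<open>1 / \<delta>\<close>, hence stable under uniform approximation even near zeros of the
  approximated function.\<close>

lemma ln_max_diff_le:
  fixes a b \<delta> \<eta> :: real
  assumes "\<bar>a - b\<bar> \<le> \<eta>" "0 < \<delta>" "0 < b"
  shows "ln b - \<eta> / \<delta> \<le> ln (max a \<delta>)"
proof -
  have m: "max a \<delta> \<ge> \<delta>" "max b \<delta> \<le> max a \<delta> + \<eta>" using assms by auto
  have "ln b \<le> ln (max b \<delta>)" using assms by simp
  also have "\<dots> \<le> ln (max a \<delta> + \<eta>)" using m assms by (subst ln_le_cancel_iff) auto
  also have "max a \<delta> + \<eta> = max a \<delta> * (1 + \<eta> / max a \<delta>)" using assms m by (simp add: field_simps)
  also have "ln \<dots> = ln (max a \<delta>) + ln (1 + \<eta> / max a \<delta>)"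
    using assms m by (intro ln_mult_pos) (auto intro!: add_pos_nonneg divide_nonneg_pos)
  also have "ln (1 + \<eta> / max a \<delta>) \<le> \<eta> / max a \<delta>"
    using assms m by (intro ln_add_one_self_le_self) (auto intro!: divide_nonneg_pos)
  also have "\<eta> / max a \<delta> \<le> \<eta> / \<delta>" using assms m by (intro divide_left_mono) auto
  finally show ?thesis by simp
qed

lemma ln_max_norm_continuous_circle:
  assumes "X holomorphic_on ball 0 R" "1 < R" "0 < \<delta>"
  shows "continuous_on {0..2*pi} (\<lambda>t. ln (max (norm (X (cis t))) \<delta>))"
proof -
  have c: "continuous_on {0..2*pi} (\<lambda>t. X (cis t))"
    by (rule continuous_on_compose2[OF holomorphic_on_imp_continuous_on[OF assms(1)] continuous_on_cis[OF continuous_on_id]])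
       (use assms(2) in auto)
  have "0 < max (norm (X (cis t))) \<delta>" for t using assms(3) by simp
  hence n: "\<forall>t\<in>{0..2*pi}. max (norm (X (cis t))) \<delta> \<noteq> 0" by (metis less_irrefl)
  show ?thesis by (rule continuous_on_ln[OF continuous_on_max[OF continuous_on_norm[OF c] continuous_on_const] n])
qed

text \<open>Truncation makes zeros of \<open>X\<close> on the circle harmless: \<open>X\<close> is
  approximated by a polynomial with the same value at 0 and no zeros on the circle, at an
  arbitrarily small cost in the logarithm.\<close>

proposition jensen_ln_max:
  assumes "X holomorphic_on ball 0 R" "1 < R" "X 0 \<noteq> 0" "0 < \<delta>"
  shows "2 * pi * ln (norm (X 0)) \<le> integral {0..2*pi} (\<lambda>t. ln (max (norm (X (cis t))) \<delta>))"
proof (rule field_le_epsilon)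
  fix e :: real assume "e > 0"
  \<comment> \<open>Chosen so that the pointwise loss \<open>\<eta> / \<delta>\<close> integrates to
    exactly \<open>e\<close>.\<close>
  define \<eta> where "\<eta> = e * \<delta> / (2 * pi)"
  have \<eta>: "\<eta> > 0" using \<open>e > 0\<close> assms(4) by (simp add: \<eta>_def)
  obtain p where p: "poly p 0 = X 0" "\<And>z. norm z \<le> 1 \<Longrightarrow> norm (X z - poly p z) < \<eta> / 2"
    using holomorphic_poly_approx_cball[OF assms(1,2), of "\<eta> / 2"] \<eta> by auto
  obtain q where q: "poly q 0 = poly p 0" "\<And>z. norm z = 1 \<Longrightarrow> poly q z \<noteq> 0"
    "\<And>z. norm z = 1 \<Longrightarrow> norm (poly p z - poly q z) < \<eta> / 2"
    using poly_approx_no_roots_on_circle[of p "\<eta> / 2"] p(1) assms(3) \<eta> by auto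
  have d: "\<bar>norm (X (cis t)) - norm (poly q (cis t))\<bar> \<le> \<eta>" for t
  proof -
    have "norm (X (cis t) - poly q (cis t)) \<le> norm (X (cis t) - poly p (cis t)) + norm (poly p (cis t) - poly q (cis t))"
      using norm_triangle_ineq[of "X (cis t) - poly p (cis t)" "poly p (cis t) - poly q (cis t)"] by simp
    also have "\<dots> \<le> \<eta>" using p(2)[of "cis t"] q(3)[of "cis t"] by simp
    finally show ?thesis by (meson norm_triangle_ineq3 order_trans)
  qed
  have c: "continuous_on {0..2*pi} (\<lambda>t. ln (norm (poly q (cis t))))"
    by (rule ln_norm_continuous_circle[of "poly q"]) (intro continuous_intros, use q(2) in force)
  have "2 * pi * ln (norm (X 0)) - e \<le> integral {0..2*pi} (\<lambda>t. ln (norm (poly q (cis t)))) - e"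
    using jensen_poly[of q] q p assms(3) by simp
  also have "\<dots> = integral {0..2*pi} (\<lambda>t. ln (norm (poly q (cis t))) - \<eta> / \<delta>)"
    using assms(4) by (subst integral_diff[OF integrable_continuous_interval[OF c]]) (auto simp: \<eta>_def)
  also have "\<dots> \<le> integral {0..2*pi} (\<lambda>t. ln (max (norm (X (cis t))) \<delta>))"
  proof (rule integral_le)
    show "(\<lambda>t. ln (norm (poly q (cis t))) - \<eta> / \<delta>) integrable_on {0..2*pi}"
      by (intro integrable_diff integrable_continuous_interval[OF c]) auto
    show "(\<lambda>t. ln (max (norm (X (cis t))) \<delta>)) integrable_on {0..2*pi}"
      by (rule integrable_continuous_interval[OF ln_max_norm_continuous_circle[OF assms(1,2,4)]])
    show "ln (norm (poly q (cis t))) - \<eta> / \<delta> \<le> ln (max (norm (X (cis t))) \<delta>)" for t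
      using ln_max_diff_le[OF d assms(4)] q(2)[of "cis t"] by simp
  qed
  finally show "2 * pi * ln (norm (X 0)) \<le> integral {0..2*pi} (\<lambda>t. ln (max (norm (X (cis t))) \<delta>)) + e"
    by simp
qed

subsection \<open>Near-constancy of the speed of a singular inner function\<close>

text \<open>For unimodular \<open>w\<close> the contribution \<open>1 / (norm (1 - w))\<^sup>2\<close> of an atom is the boundary value of the
  Koebe function \<open>- w / (1 - w)\<^sup>2\<close>. Multiplying \<open>1 / (1 - w)\<^sup>2\<close> by \<open>(1 - y ^ m)\<^sup>2\<close> with \<open>y = e / (1 - w + e)\<close>
  cancels the double pole and changes the value only by a factor \<open>1 + O(\<kappa> ^ m)\<close> where
  \<open>e \<le> \<kappa> * norm (1 - w)\<close>; the result is the following kernel.\<close>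

definition sing_kernel :: "nat \<Rightarrow> real \<Rightarrow> complex \<Rightarrow> complex" where
  "sing_kernel m e w = (1 / (1 - w + of_real e))\<^sup>2 * (\<Sum>i<m. (of_real e / (1 - w + of_real e)) ^ i)\<^sup>2"

lemma norm_shift_ge:
  fixes w :: complex
  assumes "norm w \<le> 1" "0 < e"
  shows "(norm (1 - w))\<^sup>2 + e\<^sup>2 \<le> (norm (1 - w + of_real e))\<^sup>2" "e \<le> norm (1 - w + of_real e)"
proof -
  have "Re w \<le> 1" using assms(1) complex_Re_le_cmod[of w] by linarith
  hence "0 \<le> (1 - Re w) * e" using assms by simp
  thus le: "(norm (1 - w))\<^sup>2 + e\<^sup>2 \<le> (norm (1 - w + of_real e))\<^sup>2"
    unfolding cmod_power2 by (simp add: power2_eq_square algebra_simps)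
  have "e\<^sup>2 \<le> (norm (1 - w + of_real e))\<^sup>2" using le zero_le_power2[of "norm (1 - w)"] by linarith
  thus "e \<le> norm (1 - w + of_real e)" using power2_le_imp_le by fastforce
qed

text \<open>Each of the \<open>m\<close> terms of the geometric sum has modulus at most 1 on the
  closed disc. The bound stays finite at \<open>w = 1\<close>, where the Koebe function has its
  pole.\<close>

lemma norm_sing_kernel_le:
  assumes "norm w \<le> 1" "0 < e"
  shows "norm (sing_kernel m e w) \<le> (real m)\<^sup>2 / ((norm (1 - w))\<^sup>2 + e\<^sup>2)"
proof -
  note ge = norm_shift_ge[OF assms]
  have "norm (\<Sum>i<m. (of_real e / (1 - w + of_real e)) ^ i) \<le> (\<Sum>i<m. 1)"
  proof (rule sum_norm_le)
    fix i
    have "norm (of_real e / (1 - w + of_real e)) \<le> 1"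
      using ge(2) assms(2) by (simp add: norm_divide divide_le_eq)
    thus "norm ((of_real e / (1 - w + of_real e)) ^ i) \<le> 1" by (simp add: norm_power power_le_one)
  qed
  hence S: "(norm (\<Sum>i<m. (of_real e / (1 - w + of_real e)) ^ i))\<^sup>2 \<le> (real m)\<^sup>2" by (intro power_mono) auto
  have pos: "0 < (norm (1 - w))\<^sup>2 + e\<^sup>2" using assms(2) by (simp add: add_nonneg_pos)
  have "norm (sing_kernel m e w) = 1 / (norm (1 - w + of_real e))\<^sup>2 * (norm (\<Sum>i<m. (of_real e / (1 - w + of_real e)) ^ i))\<^sup>2"
    by (simp add: sing_kernel_def norm_mult norm_power norm_divide power_divide)
  also have "\<dots> \<le> 1 / ((norm (1 - w))\<^sup>2 + e\<^sup>2) * (real m)\<^sup>2"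
    using ge(1) pos S by (intro mult_mono divide_left_mono mult_pos_pos) (auto intro: less_le_trans[OF pos])
  finally show ?thesis by simp
qed

text \<open>Summing the geometric series turns the pole-free form into the one that can be compared
  with the Koebe function.\<close>

lemma sing_kernel_eq:
  assumes "norm w \<le> 1" "0 < e" "w \<noteq> 1"
  shows "sing_kernel m e w = (1 - (of_real e / (1 - w + of_real e)) ^ m)\<^sup>2 / (1 - w)\<^sup>2"
proof -
  define y where "y = of_real e / (1 - w + of_real e)"
  have nz: "1 - w + of_real e \<noteq> 0" using norm_shift_ge(2)[OF assms(1,2)] assms(2) by force
  have y: "1 - y = (1 - w) / (1 - w + of_real e)" using nz by (simp add: y_def field_simps)
  have "(1 - y) * (\<Sum>i<m. y ^ i) = 1 - y ^ m" by (rule one_diff_power_eq [symmetric])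
  hence "(\<Sum>i<m. y ^ i) = (1 - y ^ m) * (1 - w + of_real e) / (1 - w)"
    using nz assms(3) unfolding y by (simp add: field_simps)
  thus ?thesis using nz assms(3)
    unfolding sing_kernel_def y_def[symmetric] by (simp add: power_divide power_mult_distrib)
qed

lemma circle_koebe:
  fixes w :: complex
  assumes "norm w = 1" "w \<noteq> 1"
  shows "- w / (1 - w)\<^sup>2 = of_real (1 / (norm (1 - w))\<^sup>2)"
proof -
  have "w * cnj w = 1" using assms(1) by (simp add: complex_norm_square[symmetric])
  hence "(1 - w)\<^sup>2 = - w * ((1 - w) * cnj (1 - w))" by (simp add: power2_eq_square algebra_simps)
  also have "(1 - w) * cnj (1 - w) = of_real ((norm (1 - w))\<^sup>2)" by (simp only: complex_norm_square)
  finally have "(1 - w)\<^sup>2 = - w * of_real ((norm (1 - w))\<^sup>2)" .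
  moreover have "w \<noteq> 0" using assms by auto
  ultimately show ?thesis using assms by (simp add: field_simps)
qed

text \<open>For \<open>y = (e / (1 - w + e)) ^ m\<close> the relative error is
  \<open>(1 - y)\<^sup>2 - 1 = y * (y - 2)\<close>, with \<open>norm y \<le> \<kappa> ^ m\<close>
  and \<open>norm (y - 2) \<le> 3\<close>.\<close>

lemma sing_kernel_approx:
  assumes "norm w = 1" "w \<noteq> 1" "0 < e" "e \<le> \<kappa> * norm (1 - w)" "\<kappa> \<le> 1"
  shows "norm (- w * sing_kernel m e w - of_real (1 / (norm (1 - w))\<^sup>2)) \<le> 3 * \<kappa> ^ m / (norm (1 - w))\<^sup>2"
proof -
  define y where "y = (of_real e / (1 - w + of_real e)) ^ m"
  have np: "norm (1 - w) > 0" using assms(2) by simp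
  have k0: "0 < \<kappa>" using assms(3,4) np by (smt (verit) mult_nonpos_nonneg)
  have "(norm (1 - w))\<^sup>2 \<le> (norm (1 - w + of_real e))\<^sup>2"
    using norm_shift_ge(1)[of w e] assms zero_le_power2[of e] by linarith
  hence le: "norm (1 - w) \<le> norm (1 - w + of_real e)" using power2_le_imp_le by fastforce
  have "norm (of_real e / (1 - w + of_real e)) = e / norm (1 - w + of_real e)"
    using assms(3) by (simp add: norm_divide)
  also have "\<dots> \<le> e / norm (1 - w)" using le np assms(3) by (intro divide_left_mono mult_pos_pos) auto
  also have "\<dots> \<le> \<kappa>" using assms(4) np by (simp add: divide_le_eq)
  finally have ny: "norm y \<le> \<kappa> ^ m" unfolding y_def norm_power by (intro power_mono) auto
  have k1: "\<kappa> ^ m \<le> 1" using k0 assms(5) by (simp add: power_le_one)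
  have "- w * sing_kernel m e w - of_real (1 / (norm (1 - w))\<^sup>2) = - w / (1 - w)\<^sup>2 * ((1 - y)\<^sup>2 - 1)"
    unfolding circle_koebe[OF assms(1,2), symmetric] y_def
    using assms by (subst sing_kernel_eq) (auto simp: algebra_simps)
  also have "norm \<dots> = norm ((1 - y)\<^sup>2 - 1) / (norm (1 - w))\<^sup>2"
    using assms(1) by (simp add: norm_mult norm_divide norm_power)
  also have "norm ((1 - y)\<^sup>2 - 1) \<le> 3 * \<kappa> ^ m"
  proof -
    have "(1 - y)\<^sup>2 - 1 = y * (y - 2)" by (simp add: power2_eq_square algebra_simps)
    hence "norm ((1 - y)\<^sup>2 - 1) = norm y * norm (y - 2)" by (simp add: norm_mult)
    also have "norm (y - 2) \<le> 3" using norm_triangle_ineq4[of y 2] ny k1 by simp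
    also have "norm y * 3 \<le> \<kappa> ^ m * 3" using ny by simp
    finally show ?thesis by (simp add: mult_left_mono)
  qed
  finally show ?thesis using np by (simp add: divide_right_mono)
qed

lemma sing_kernel_holomorphic:
  assumes "0 < e"
  shows "sing_kernel m e holomorphic_on ball 0 (1 + e)"
proof -
  have "1 - w + of_real e \<noteq> 0" if "w \<in> ball 0 (1 + e)" for w :: complex
  proof
    assume "1 - w + of_real e = 0"
    hence "w = of_real (1 + e)" by (simp add: algebra_simps)
    hence "norm w = 1 + e" using assms by (simp only: norm_of_real)
    thus False using that by simp
  qed
  thus ?thesis unfolding sing_kernel_def[abs_def] by (intro holomorphic_intros) auto
qed

text \<open>For \<open>norm z = 1\<close> off the atoms this is the rate at which the argument of
  \<open>exp\<close> of minus the sum of \<open>lam j * (1 + al j * w) / (1 - al j * w)\<close>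
  turns at \<open>w = cnj z\<close>; the poles of that sum are the points \<open>cnj (al j)\<close>.
  At an atom, division by zero turns the infinite term into 0.\<close>

definition atom_speed :: "nat \<Rightarrow> (nat \<Rightarrow> real) \<Rightarrow> (nat \<Rightarrow> complex) \<Rightarrow> complex \<Rightarrow> real" where
  "atom_speed N lam al z = (\<Sum>j<N. 2 * lam j / (norm (z - al j))\<^sup>2)"

lemma norm_one_minus_cnj:
  assumes "norm a = 1"
  shows "norm (1 - cnj a * z) = norm (z - a)"
proof -
  have "a * cnj a = 1" using assms by (simp add: complex_norm_square[symmetric])
  hence "z - a = - a * (1 - cnj a * z)" by (simp add: algebra_simps)
  hence "norm (z - a) = norm a * norm (1 - cnj a * z)" by (simp only: norm_mult norm_minus_cancel)
  thus ?thesis using assms by simp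
qed

text \<open>The Koebe function of each atom is replaced by a \<open>sing_kernel\<close> of width
  \<kappa> times the distance of the atom from \<open>G\<close>, and \<open>X\<close> is the
  resulting sum over \<nu>, minus 1. The positive widths give holomorphy beyond the disc, and the
  factor \<open>- w\<close> gives \<open>X 0 = -1\<close>. On \<open>G\<close> the kernel error is
  of order \<open>\<kappa> ^ m\<close>; elsewhere on the circle the sum is compared with the speed
  at one well-chosen point of \<open>G\<close>.\<close>

lemma regularised_speed:
  fixes lam :: "nat \<Rightarrow> real" and al :: "nat \<Rightarrow> complex"
  assumes at: "\<And>j. j < N \<Longrightarrow> 0 < lam j \<and> norm (al j) = 1"
    and G: "G \<noteq> {}" "\<And>g. g \<in> G \<Longrightarrow> norm g = 1" "\<And>g j. g \<in> G \<Longrightarrow> j < N \<Longrightarrow> g \<noteq> al j"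
    and \<nu>: "0 < \<nu>"
    and near: "\<And>g. g \<in> G \<Longrightarrow> \<bar>atom_speed N lam al g - \<nu>\<bar> \<le> \<kappa> ^ m * (atom_speed N lam al g + \<nu>)"
    and \<kappa>: "0 < \<kappa>" "\<kappa> ^ m \<le> 1 / 4" "\<kappa> \<le> 1" "1 \<le> m"
  obtains X R where "X holomorphic_on ball 0 R" "1 < R" "X 0 = -1"
    "\<And>z. norm z = 1 \<Longrightarrow> norm (X z) \<le> 17 * (real m)\<^sup>2 / \<kappa>\<^sup>2"
    "\<And>g. g \<in> G \<Longrightarrow> norm (X g) \<le> 9 * \<kappa> ^ m"
proof -
  let ?\<omega> = "atom_speed N lam al"
  \<comment> \<open>With \<open>\<kappa> ^ m \<le> 1 / 4\<close> the nearness condition already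
    gives \<open>3 * ?\<omega> g \<le> 5 * \<nu>\<close>.\<close>
  have \<omega>2: "?\<omega> g \<le> 2 * \<nu>" if "g \<in> G" for g
  proof -
    have nn: "0 \<le> ?\<omega> g" unfolding atom_speed_def using at by (intro sum_nonneg divide_nonneg_nonneg) (auto intro: less_imp_le)
    have "\<kappa> ^ m * (?\<omega> g + \<nu>) \<le> 1 / 4 * (?\<omega> g + \<nu>)" using \<kappa> nn \<nu> by (intro mult_right_mono) auto
    hence "\<bar>?\<omega> g - \<nu>\<bar> \<le> 1 / 4 * (?\<omega> g + \<nu>)" using near[OF that] by (rule order_trans[rotated])
    hence "?\<omega> g - \<nu> \<le> 1 / 4 * (?\<omega> g + \<nu>)" by (rule order_trans[OF abs_ge_self])
    thus ?thesis using \<nu> by (simp add: field_simps)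
  qed
  define d where "d j = infdist (al j) G" for j
  have d_le: "d j \<le> norm (g - al j)" if "g \<in> G" for g j
    using infdist_le[OF that, of "al j"] by (simp add: d_def dist_norm norm_minus_commute)
  \<comment> \<open>An atom closer to \<open>g\<close> than \<open>sqrt (lam j / \<nu>)\<close>
    would by itself push the speed above \<open>2 * \<nu>\<close>; so \<open>G\<close> cannot
    accumulate at an atom.\<close>
  have d_pos: "0 < d j" if "j < N" for j
  proof -
    have "sqrt (lam j / \<nu>) \<le> norm (g - al j)" if g: "g \<in> G" for g
    proof -
      have p: "0 < norm (g - al j)" using G(3)[OF g \<open>j < N\<close>] by simp
      have "2 * lam j / (norm (g - al j))\<^sup>2 \<le> ?\<omega> g" unfolding atom_speed_def
        using \<open>j < N\<close> at by (intro member_le_sum divide_nonneg_nonneg) (auto intro: less_imp_le)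
      hence "2 * lam j / (norm (g - al j))\<^sup>2 \<le> 2 * \<nu>" using \<omega>2[OF g] by linarith
      hence "lam j / \<nu> \<le> (norm (g - al j))\<^sup>2" using p \<nu> by (simp add: field_simps)
      thus ?thesis using real_sqrt_le_iff[of "lam j / \<nu>" "(norm (g - al j))\<^sup>2"] by (simp del: real_sqrt_le_iff)
    qed
    hence "sqrt (lam j / \<nu>) \<le> d j" unfolding d_def infdist_notempty[OF G(1)]
      by (intro cINF_greatest[OF G(1)]) (simp add: dist_norm norm_minus_commute)
    moreover have "0 < sqrt (lam j / \<nu>)" using at[OF that] \<nu> by simp
    ultimately show ?thesis by linarith
  qed
  \<comment> \<open>A common lower bound of the distances serves twice: as slack when an infimum
    over \<open>G\<close> is only nearly attained, and as the margin by which \<open>X\<close>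
    extends beyond the disc.\<close>
  obtain d0 where d0: "0 < d0" "\<And>j. j < N \<Longrightarrow> d0 \<le> d j"
  proof (cases "N = 0")
    case False
    have "Min (d ` {..<N}) > 0" using d_pos False by (subst Min_gr_iff) auto
    thus ?thesis using that[of "Min (d ` {..<N})"] by auto
  qed (use that[of 1] in auto)
  define k where "k j z = - (cnj (al j) * z) * sing_kernel m (\<kappa> * d j) (cnj (al j) * z)" for j z
  define X where "X z = of_real (1 / \<nu>) * (\<Sum>j<N. of_real (2 * lam j) * k j z) - 1" for z
  \<comment> \<open>The regularisation width of each atom is proportional to its distance from \<open>G\<close>, which is
    1-Lipschitz; so a near-optimal point of \<open>G\<close> controls all atoms simultaneously.\<close>
  have near_pt: "\<exists>g\<in>G. \<forall>j<N. norm (g - al j) \<le> 2 * (norm (z - al j) + d j)" for z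
  proof -
    have "infdist z G < infdist z G + d0" using d0(1) by simp
    then obtain g where g: "g \<in> G" "dist z g < infdist z G + d0"
      unfolding infdist_notempty[OF G(1)] by (subst (asm) cINF_less_iff[OF G(1)]) auto
    have "norm (g - al j) \<le> 2 * (norm (z - al j) + d j)" if "j < N" for j
    proof -
      have "norm (g - al j) \<le> dist z g + norm (z - al j)"
        using dist_triangle[of g "al j" z] by (simp add: dist_norm norm_minus_commute)
      also have "dist z g \<le> infdist z G + d0" using g by simp
      also have "infdist z G \<le> d j + norm (z - al j)"
        using infdist_triangle[of z G "al j"] by (simp add: d_def dist_norm)
      finally show ?thesis using d0(2)[OF that] by simp
    qed
    thus ?thesis using g by blast
  qed
  show ?thesis
  proof
    show "1 < 1 + \<kappa> * d0" using \<kappa> d0 by simp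
    show "X holomorphic_on ball 0 (1 + \<kappa> * d0)"
    proof -
      have "(\<lambda>z. sing_kernel m (\<kappa> * d j) (cnj (al j) * z)) holomorphic_on ball 0 (1 + \<kappa> * d0)" if j: "j < N" for j
      proof -
        have "(sing_kernel m (\<kappa> * d j) \<circ> (\<lambda>z. cnj (al j) * z)) holomorphic_on ball 0 (1 + \<kappa> * d0)"
        proof (rule holomorphic_on_compose_gen)
          show "sing_kernel m (\<kappa> * d j) holomorphic_on ball 0 (1 + \<kappa> * d j)"
            using d_pos[OF j] \<kappa> by (intro sing_kernel_holomorphic) auto
          have "\<kappa> * d0 \<le> \<kappa> * d j" using d0(2)[OF j] \<kappa> by simp
          thus "(\<lambda>z. cnj (al j) * z) ` ball 0 (1 + \<kappa> * d0) \<subseteq> ball 0 (1 + \<kappa> * d j)"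
            using at[OF j] by (auto simp: norm_mult)
        qed (intro holomorphic_intros)
        thus ?thesis by (simp add: o_def)
      qed
      thus ?thesis unfolding X_def k_def by (intro holomorphic_intros) auto
    qed
    show "X 0 = -1" by (simp add: X_def k_def)
  next
    fix z :: complex assume z: "norm z = 1"
    obtain g where g: "g \<in> G" "\<And>j. j < N \<Longrightarrow> norm (g - al j) \<le> 2 * (norm (z - al j) + d j)"
      using near_pt[of z] by blast
    have kb: "norm (k j z) \<le> 8 * (real m)\<^sup>2 / \<kappa>\<^sup>2 * (1 / (norm (g - al j))\<^sup>2)" if j: "j < N" for j
    proof -
      have w: "norm (cnj (al j) * z) = 1" "norm (1 - cnj (al j) * z) = norm (z - al j)"
        using z at[OF j] by (auto simp: norm_mult norm_one_minus_cnj)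
      have p: "0 < norm (g - al j)" using G(3)[OF g(1) j] by simp
      have "(norm (g - al j))\<^sup>2 \<le> (2 * (norm (z - al j) + d j))\<^sup>2" using g(2)[OF j] by (intro power_mono) auto
      also have "\<dots> \<le> 8 * ((norm (z - al j))\<^sup>2 + (d j)\<^sup>2)"
        using zero_le_power2[of "norm (z - al j) - d j"] by (simp add: power2_eq_square algebra_simps)
      finally have "\<kappa>\<^sup>2 * (norm (g - al j))\<^sup>2 \<le> \<kappa>\<^sup>2 * (8 * ((norm (z - al j))\<^sup>2 + (d j)\<^sup>2))"
        by (intro mult_left_mono) auto
      also have "\<dots> \<le> 8 * ((norm (z - al j))\<^sup>2 + (\<kappa> * d j)\<^sup>2)"
      proof -
        have "\<kappa>\<^sup>2 * (norm (z - al j))\<^sup>2 \<le> 1 * (norm (z - al j))\<^sup>2"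
          using \<kappa> by (intro mult_right_mono power_le_one) auto
        thus ?thesis by (simp add: power_mult_distrib algebra_simps)
      qed
      finally have le: "\<kappa>\<^sup>2 * (norm (g - al j))\<^sup>2 / 8 \<le> (norm (z - al j))\<^sup>2 + (\<kappa> * d j)\<^sup>2" by simp
      have "norm (k j z) = norm (sing_kernel m (\<kappa> * d j) (cnj (al j) * z))"
        using w by (simp add: k_def norm_mult)
      also have "\<dots> \<le> (real m)\<^sup>2 / ((norm (z - al j))\<^sup>2 + (\<kappa> * d j)\<^sup>2)"
        using norm_sing_kernel_le[of "cnj (al j) * z" "\<kappa> * d j" m] w \<kappa> d_pos[OF j] by simp
      also have "\<dots> \<le> (real m)\<^sup>2 / (\<kappa>\<^sup>2 * (norm (g - al j))\<^sup>2 / 8)"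
      proof -
        have "0 < (norm (z - al j))\<^sup>2 + (\<kappa> * d j)\<^sup>2"
          using d_pos[OF j] \<kappa> by (intro add_nonneg_pos) auto
        moreover have "0 < \<kappa>\<^sup>2 * (norm (g - al j))\<^sup>2 / 8" using p \<kappa> by simp
        ultimately show ?thesis using le by (intro divide_left_mono mult_pos_pos) auto
      qed
      finally show ?thesis by (simp add: field_simps)
    qed
    have "norm (\<Sum>j<N. of_real (2 * lam j) * k j z) \<le> (\<Sum>j<N. 8 * (real m)\<^sup>2 / \<kappa>\<^sup>2 * (2 * lam j / (norm (g - al j))\<^sup>2))"
    proof (rule sum_norm_le)
      fix j assume "j \<in> {..<N}"
      hence j: "j < N" by simp
      have "norm (of_real (2 * lam j) * k j z) = 2 * lam j * norm (k j z)" using at[OF j] by (simp add: norm_mult)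
      also have "\<dots> \<le> 2 * lam j * (8 * (real m)\<^sup>2 / \<kappa>\<^sup>2 * (1 / (norm (g - al j))\<^sup>2))"
        using kb[OF j] at[OF j] by (intro mult_left_mono) auto
      finally show "norm (of_real (2 * lam j) * k j z) \<le> 8 * (real m)\<^sup>2 / \<kappa>\<^sup>2 * (2 * lam j / (norm (g - al j))\<^sup>2)"
        by (simp add: field_simps)
    qed
    also have "\<dots> = 8 * (real m)\<^sup>2 / \<kappa>\<^sup>2 * ?\<omega> g" by (simp add: atom_speed_def sum_distrib_left)
    also have "\<dots> \<le> 8 * (real m)\<^sup>2 / \<kappa>\<^sup>2 * (2 * \<nu>)" using \<omega>2[OF g(1)] by (intro mult_left_mono) auto
    finally have S: "norm (\<Sum>j<N. of_real (2 * lam j) * k j z) \<le> 16 * (real m)\<^sup>2 / \<kappa>\<^sup>2 * \<nu>" by simp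
    have "norm (X z) \<le> 1 / \<nu> * norm (\<Sum>j<N. of_real (2 * lam j) * k j z) + 1"
      unfolding X_def using norm_triangle_ineq4[of "of_real (1 / \<nu>) * (\<Sum>j<N. of_real (2 * lam j) * k j z)" 1] \<nu>
      by (simp add: norm_mult norm_divide)
    also have "\<dots> \<le> 1 / \<nu> * (16 * (real m)\<^sup>2 / \<kappa>\<^sup>2 * \<nu>) + 1"
      using S \<nu> by (intro add_right_mono mult_left_mono) auto
    also have "\<dots> = 16 * ((real m)\<^sup>2 / \<kappa>\<^sup>2) + 1" using \<nu> by simp
    \<comment> \<open>Absorbs the constant term of \<open>X\<close>, turning 16 into 17.\<close>
    also have "1 \<le> (real m)\<^sup>2 / \<kappa>\<^sup>2"
    proof -
      have "\<kappa>\<^sup>2 \<le> 1" using \<kappa> by (intro power_le_one) auto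
      also have "1 \<le> (real m)\<^sup>2" using \<kappa>(4) by simp
      finally show ?thesis using \<kappa> by simp
    qed
    finally show "norm (X z) \<le> 17 * (real m)\<^sup>2 / \<kappa>\<^sup>2" by simp
  next
    fix g assume g: "g \<in> G"
    have kb: "norm (k j g - of_real (1 / (norm (g - al j))\<^sup>2)) \<le> 3 * \<kappa> ^ m / (norm (g - al j))\<^sup>2" if j: "j < N" for j
    proof -
      have w: "norm (cnj (al j) * g) = 1" "norm (1 - cnj (al j) * g) = norm (g - al j)"
        using G(2)[OF g] at[OF j] by (auto simp: norm_mult norm_one_minus_cnj)
      have ne: "cnj (al j) * g \<noteq> 1" using w(2) G(3)[OF g j] by auto
      have "\<kappa> * d j \<le> \<kappa> * norm (1 - cnj (al j) * g)" using d_le[OF g, of j] \<kappa> w by simp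
      thus ?thesis unfolding k_def
        using sing_kernel_approx[OF w(1) ne, of "\<kappa> * d j" \<kappa> m] \<kappa> d_pos[OF j] w(2) by simp
    qed
    have "norm ((\<Sum>j<N. of_real (2 * lam j) * k j g) - of_real (?\<omega> g))
        = norm (\<Sum>j<N. of_real (2 * lam j) * (k j g - of_real (1 / (norm (g - al j))\<^sup>2)))"
      by (simp add: atom_speed_def sum_subtractf right_diff_distrib)
    also have "\<dots> \<le> (\<Sum>j<N. 3 * \<kappa> ^ m * (2 * lam j / (norm (g - al j))\<^sup>2))"
    proof (rule sum_norm_le)
      fix j assume "j \<in> {..<N}"
      hence j: "j < N" by simp
      have "norm (of_real (2 * lam j) * (k j g - of_real (1 / (norm (g - al j))\<^sup>2)))
          = 2 * lam j * norm (k j g - of_real (1 / (norm (g - al j))\<^sup>2))" using at[OF j] by (simp add: norm_mult)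
      also have "\<dots> \<le> 2 * lam j * (3 * \<kappa> ^ m / (norm (g - al j))\<^sup>2)"
        using kb[OF j] at[OF j] by (intro mult_left_mono) auto
      finally show "norm (of_real (2 * lam j) * (k j g - of_real (1 / (norm (g - al j))\<^sup>2)))
          \<le> 3 * \<kappa> ^ m * (2 * lam j / (norm (g - al j))\<^sup>2)" by (simp add: mult_ac)
    qed
    also have "\<dots> = 3 * \<kappa> ^ m * ?\<omega> g" by (simp add: atom_speed_def sum_distrib_left)
    also have "\<dots> \<le> 3 * \<kappa> ^ m * (2 * \<nu>)" using \<omega>2[OF g] \<kappa> by (intro mult_left_mono) auto
    finally have 1: "norm ((\<Sum>j<N. of_real (2 * lam j) * k j g) - of_real (?\<omega> g)) \<le> 6 * \<kappa> ^ m * \<nu>" by simp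
    have "\<kappa> ^ m * (?\<omega> g + \<nu>) \<le> \<kappa> ^ m * (3 * \<nu>)" using \<omega>2[OF g] \<kappa> by (intro mult_left_mono) auto
    hence 2: "norm (complex_of_real (?\<omega> g - \<nu>)) \<le> 3 * \<kappa> ^ m * \<nu>" using near[OF g] unfolding norm_of_real by simp
    have "X g = of_real (1 / \<nu>) * (((\<Sum>j<N. of_real (2 * lam j) * k j g) - of_real (?\<omega> g)) + of_real (?\<omega> g - \<nu>))"
      using \<nu> by (simp add: X_def field_simps)
    hence "norm (X g) = 1 / \<nu> * norm (((\<Sum>j<N. of_real (2 * lam j) * k j g) - of_real (?\<omega> g)) + of_real (?\<omega> g - \<nu>))"
      using \<nu> by (simp only: norm_mult norm_of_real) simp
    also have "\<dots> \<le> 1 / \<nu> * (6 * \<kappa> ^ m * \<nu> + 3 * \<kappa> ^ m * \<nu>)"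
      using 1 2 \<nu> by (intro mult_left_mono order_trans[OF norm_triangle_ineq] add_mono) auto
    finally show "norm (X g) \<le> 9 * \<kappa> ^ m" using \<nu> by (simp add: field_simps)
  qed
qed

section \<open>The normalised speed and how often it is small\<close>

definition rel_speed :: "nat \<Rightarrow> (nat \<Rightarrow> real) \<Rightarrow> (nat \<Rightarrow> complex) \<Rightarrow> real \<Rightarrow> complex \<Rightarrow> real" where
  "rel_speed N lam al \<nu> z =
     (if z \<in> al ` {..<N} then 1
      else (atom_speed N lam al z - \<nu>) / (atom_speed N lam al z + \<nu>))"

lemma atom_speed_ge:
  assumes "\<And>j. j < N \<Longrightarrow> 0 < lam j" "j < N"
  shows "2 * lam j / (norm (z - al j))\<^sup>2 \<le> atom_speed N lam al z"
  unfolding atom_speed_def using assms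
  by (intro member_le_sum divide_nonneg_nonneg) (auto intro: less_imp_le)

lemma atom_speed_nonneg:
  assumes "\<And>j. j < N \<Longrightarrow> 0 < lam j"
  shows "0 \<le> atom_speed N lam al z"
  unfolding atom_speed_def using assms
  by (intro sum_nonneg divide_nonneg_nonneg) (auto intro: less_imp_le)

text \<open>Off the atoms \<open>1 - X = 2 * \<nu> / (\<omega> + \<nu>)\<close>, and a single term
  bounds \<omega> from below. The resulting quadratic decay shows that the value 1 assigned at the
  atoms is the limit there.\<close>

lemma one_minus_rel_speed_le:
  assumes "\<And>j. j < N \<Longrightarrow> 0 < lam j" "0 < \<nu>" "j < N"
  shows "\<bar>1 - rel_speed N lam al \<nu> z\<bar> \<le> \<nu> / lam j * (norm (z - al j))\<^sup>2"
proof (cases "z \<in> al ` {..<N}")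
  case False
  define w where "w = atom_speed N lam al z"
  have ge: "2 * lam j / (norm (z - al j))\<^sup>2 \<le> w" unfolding w_def by (rule atom_speed_ge) (use assms in auto)
  have p: "0 < (norm (z - al j))\<^sup>2" using False assms(3) by auto
  have l: "0 < lam j" using assms by auto
  have w: "0 < w" using ge p l by (smt (verit) divide_pos_pos)
  have "1 - rel_speed N lam al \<nu> z = 2 * \<nu> / (w + \<nu>)"
    using False w assms(2) by (simp add: rel_speed_def w_def[symmetric] field_simps)
  hence "\<bar>1 - rel_speed N lam al \<nu> z\<bar> = 2 * \<nu> / (w + \<nu>)" using w assms(2) by simp
  also have "\<dots> \<le> 2 * \<nu> / (2 * lam j / (norm (z - al j))\<^sup>2)"
    using ge w assms(2) p l by (intro divide_left_mono mult_pos_pos divide_pos_pos) auto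
  also have "\<dots> = \<nu> / lam j * (norm (z - al j))\<^sup>2" by simp
  finally show ?thesis .
next
  case True
  have "0 \<le> \<nu> / lam j" using assms by (intro divide_nonneg_nonneg) (auto intro: less_imp_le)
  hence "0 \<le> \<nu> / lam j * (norm (z - al j))\<^sup>2" by (intro mult_nonneg_nonneg) auto
  thus ?thesis using True by (simp add: rel_speed_def)
qed

lemma rel_speed_continuous:
  assumes "\<And>j. j < N \<Longrightarrow> 0 < lam j" "0 < \<nu>"
  shows "continuous_on UNIV (rel_speed N lam al \<nu>)"
proof -
  have "isCont (rel_speed N lam al \<nu>) z" for z
  proof (cases "z \<in> al ` {..<N}")
    case True
    then obtain j where j: "j < N" "z = al j" by auto
    have "((\<lambda>x. 1 - rel_speed N lam al \<nu> x) \<longlongrightarrow> 0) (at z)"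
    proof (rule Lim_null_comparison)
      show "\<forall>\<^sub>F x in at z. norm (1 - rel_speed N lam al \<nu> x) \<le> \<nu> / lam j * (norm (x - al j))\<^sup>2"
        unfolding real_norm_def
        by (intro always_eventually allI one_minus_rel_speed_le) (use assms j(1) in auto)
      have "((\<lambda>x. \<nu> / lam j * (norm (x - al j))\<^sup>2) \<longlongrightarrow> \<nu> / lam j * (norm (z - al j))\<^sup>2) (at z)"
        by (intro tendsto_intros)
      thus "((\<lambda>x. \<nu> / lam j * (norm (x - al j))\<^sup>2) \<longlongrightarrow> 0) (at z)" using j by simp
    qed
    from tendsto_diff[OF tendsto_const[of 1] this] have "(rel_speed N lam al \<nu> \<longlongrightarrow> 1) (at z)" by simp
    thus ?thesis using True by (simp add: isCont_def rel_speed_def)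
  next
    case False
    have op: "open (- (al ` {..<N}))" by (intro open_Compl finite_imp_closed) auto
    have "continuous_on (- (al ` {..<N})) (atom_speed N lam al)"
      unfolding atom_speed_def[abs_def] by (intro continuous_intros) auto
    hence "continuous_on (- (al ` {..<N})) (\<lambda>z. (atom_speed N lam al z - \<nu>) / (atom_speed N lam al z + \<nu>))"
    proof (intro continuous_intros ballI)
      fix z
      have "0 \<le> atom_speed N lam al z" by (rule atom_speed_nonneg) (rule assms(1))
      thus "atom_speed N lam al z + \<nu> \<noteq> 0" using assms(2) by simp
    qed
    hence "continuous_on (- (al ` {..<N})) (rel_speed N lam al \<nu>)"
      by (rule continuous_on_eq) (auto simp: rel_speed_def)
    thus ?thesis using op False by (metis ComplI continuous_on_eq_continuous_at)
  qed
  thus ?thesis by (simp add: continuous_at_imp_continuous_on)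
qed

text \<open>Jensen's inequality is applied to the regularised function \<open>X\<close>, which has
  modulus 1 at 0, is at most \<open>B\<close> on the circle and at most
  \<open>9 * \<epsilon>\<close> on the set \<open>G\<close>: smallness on much of the circle would
  contradict a mean of at least 0. It matters that \<epsilon> depends on \<eta> alone, not on the
  atoms or the level.\<close>

proposition mean_near_level:
  fixes \<eta> :: real
  assumes "0 < \<eta>"
  obtains \<epsilon> :: real where "0 < \<epsilon>" "\<epsilon> \<le> 1 / 4"
    "\<forall>N lam al \<nu>. (\<forall>j<N. 0 < lam j \<and> norm (al j) = 1) \<longrightarrow> 0 < \<nu> \<longrightarrow>
       integral {0..2*pi} (\<lambda>t. max 0 (1 - \<bar>rel_speed N lam al \<nu> (cis t)\<bar> / \<epsilon>)) \<le> 2 * pi * \<eta>"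
proof -
  \<comment> \<open>With \<kappa> chosen as below, \<open>B\<close> is the cube of
    \<open>1 / \<kappa>\<close> while \<epsilon> is the \<open>m\<close>-th power of \<kappa>. The
    share of the circle that Jensen's inequality permits is then at most \<open>3 / (m - 1)\<close>,
    which this \<open>m\<close> makes at most \<eta>.\<close>
  define m where "m = nat \<lceil>3 / \<eta>\<rceil> + 1"
  define \<kappa> where "\<kappa> = 1 / (17 * (real m)\<^sup>2)"
  define B where "B = 17 * (real m)\<^sup>2 / \<kappa>\<^sup>2"
  define \<epsilon> where "\<epsilon> = \<kappa> ^ m"
  have m: "1 \<le> m" "3 \<le> \<eta> * (real m - 1)"
  proof -
    have "3 / \<eta> \<le> real m - 1" unfolding m_def by linarith
    thus "3 \<le> \<eta> * (real m - 1)" using assms by (simp add: field_simps)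
  qed (simp add: m_def)
  have "1 \<le> (real m)\<^sup>2" using m(1) by simp
  hence k: "0 < \<kappa>" "\<kappa> \<le> 1 / 17" using m(1) unfolding \<kappa>_def by (auto simp: divide_simps)
  have "\<kappa> ^ m \<le> \<kappa> ^ 1" using k m(1) by (intro power_decreasing) auto
  hence e: "0 < \<epsilon>" "\<epsilon> \<le> 1 / 17" using k by (auto simp: \<epsilon>_def)
  define L where "L = - ln \<kappa>"
  have L: "ln 9 \<le> L" "0 < L"
  proof -
    have "ln (9::real) \<le> ln (1 / \<kappa>)" using k by (subst ln_le_cancel_iff) (auto simp: field_simps)
    thus "ln 9 \<le> L" using k by (simp add: L_def ln_div)
    moreover have "0 < ln (9::real)" by simp
    ultimately show "0 < L" by linarith
  qed
  have "B = (1 / \<kappa>) ^ 3" using k(1) by (simp add: B_def \<kappa>_def power3_eq_cube power2_eq_square)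
  hence lnB: "ln B = 3 * L" "0 < B" using k by (simp_all add: L_def ln_realpow ln_div)
  \<comment> \<open>The factor 9 costs one of the \<open>m\<close> powers, by
    \<open>ln 9 \<le> L\<close>.\<close>
  have ln\<delta>: "ln (9 * \<epsilon>) \<le> - (real m - 1) * L"
    using k L by (simp add: \<epsilon>_def ln_mult ln_realpow L_def algebra_simps)
  have fin: "ln B \<le> \<eta> * (ln B - ln (9 * \<epsilon>))"
  proof -
    have "3 * L \<le> \<eta> * (real m - 1) * L" using m L by simp
    also have "\<dots> \<le> \<eta> * (- ln (9 * \<epsilon>))" using ln\<delta> assms mult_left_mono[of "(real m - 1) * L" "- ln (9 * \<epsilon>)" \<eta>]
      by (simp add: algebra_simps)
    also have "\<dots> \<le> \<eta> * (ln B - ln (9 * \<epsilon>))" using lnB L assms by (intro mult_left_mono) auto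
    finally show ?thesis using lnB by simp
  qed
  have gap: "0 < ln B - ln (9 * \<epsilon>)"
  proof -
    have "- (real m - 1) * L \<le> 0" using m(1) L by (intro mult_nonpos_nonneg) auto
    thus ?thesis using ln\<delta> lnB L by linarith
  qed
  show ?thesis
  proof
    show "0 < \<epsilon>" "\<epsilon> \<le> 1 / 4" using e by auto
  next
    show "\<forall>N lam al \<nu>. (\<forall>j<N. 0 < lam j \<and> norm (al j) = 1) \<longrightarrow> 0 < \<nu> \<longrightarrow>
       integral {0..2*pi} (\<lambda>t. max 0 (1 - \<bar>rel_speed N lam al \<nu> (cis t)\<bar> / \<epsilon>)) \<le> 2 * pi * \<eta>"
    proof (intro allI impI)
      fix N :: nat and lam :: "nat \<Rightarrow> real" and al :: "nat \<Rightarrow> complex" and \<nu> :: real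
      assume "\<forall>j<N. 0 < lam j \<and> norm (al j) = 1" and \<nu>: "0 < \<nu>"
      hence at: "\<And>j. j < N \<Longrightarrow> 0 < lam j \<and> norm (al j) = 1" by blast
      \<comment> \<open>A continuous hat replaces the indicator of \<open>G\<close>, so that only
        continuous functions have to be integrated.\<close>
      define b where "b t = max 0 (1 - \<bar>rel_speed N lam al \<nu> (cis t)\<bar> / \<epsilon>)" for t
      define G where "G = {z. norm z = 1 \<and> z \<notin> al ` {..<N} \<and> \<bar>rel_speed N lam al \<nu> z\<bar> < \<epsilon>}"
      have b1: "b t \<le> 1" "0 \<le> b t" for t using e by (auto simp: b_def)
      have bG: "cis t \<in> G" if "0 < b t" for t
      proof -
        have lt: "\<bar>rel_speed N lam al \<nu> (cis t)\<bar> < \<epsilon>" using that e by (auto simp: b_def field_simps max_def split: if_splits)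
        hence "cis t \<notin> al ` {..<N}" using e by (auto simp: rel_speed_def split: if_splits)
        thus ?thesis using lt by (simp add: G_def)
      qed
      have "continuous_on {0..2*pi} (\<lambda>t. rel_speed N lam al \<nu> (cis t))"
        by (rule continuous_on_compose2[OF rel_speed_continuous continuous_on_cis[OF continuous_on_id]])
           (use at \<nu> in auto)
      hence cb: "continuous_on {0..2*pi} b" unfolding b_def by (intro continuous_intros) (use e in auto)
      show "integral {0..2*pi} (\<lambda>t. max 0 (1 - \<bar>rel_speed N lam al \<nu> (cis t)\<bar> / \<epsilon>)) \<le> 2 * pi * \<eta>"
      proof (cases "G = {}")
        case True
        hence "b t = 0" for t using bG[of t] b1(2)[of t] by force
        thus ?thesis unfolding b_def using assms by simp
      next
        case False
        have near: "\<bar>atom_speed N lam al g - \<nu>\<bar> \<le> \<kappa> ^ m * (atom_speed N lam al g + \<nu>)" if "g \<in> G" for g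
        proof -
          have "0 < atom_speed N lam al g + \<nu>" using atom_speed_nonneg[of N lam al g] at \<nu> by force
          thus ?thesis using that by (auto simp: G_def rel_speed_def \<epsilon>_def field_simps)
        qed
        obtain X R where X: "X holomorphic_on ball 0 R" "1 < R" "X 0 = -1"
          "\<And>z. norm z = 1 \<Longrightarrow> norm (X z) \<le> B" "\<And>g. g \<in> G \<Longrightarrow> norm (X g) \<le> 9 * \<epsilon>"
        proof (rule regularised_speed[where N = N and lam = lam and al = al and G = G and \<nu> = \<nu> and \<kappa> = \<kappa> and m = m])
          show "\<And>j. j < N \<Longrightarrow> 0 < lam j \<and> norm (al j) = 1" by (rule at)
          show "G \<noteq> {}" "\<And>g. g \<in> G \<Longrightarrow> norm g = 1" "\<And>g j. g \<in> G \<Longrightarrow> j < N \<Longrightarrow> g \<noteq> al j"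
            using False by (auto simp: G_def)
          show "\<kappa> ^ m \<le> 1 / 4" "\<kappa> \<le> 1" using e k by (auto simp: \<epsilon>_def)
        qed (use \<nu> near k m that in \<open>auto simp: B_def \<epsilon>_def\<close>)
        \<comment> \<open>Interpolates between the bound on \<open>G\<close>, where the hat may be
          positive, and the global bound \<open>B\<close>, where it vanishes.\<close>
        have le: "ln (max (norm (X (cis t))) (9 * \<epsilon>)) \<le> ln B - b t * (ln B - ln (9 * \<epsilon>))" for t
        proof (cases "0 < b t")
          case True
          hence "max (norm (X (cis t))) (9 * \<epsilon>) = 9 * \<epsilon>" using X(5)[OF bG] by (simp add: max_def)
          moreover have "b t * (ln B - ln (9 * \<epsilon>)) \<le> 1 * (ln B - ln (9 * \<epsilon>))"
            using b1 gap by (intro mult_right_mono) auto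
          ultimately show ?thesis by simp
        next
          case False
          hence "b t = 0" using b1(2)[of t] by simp
          moreover have "9 * \<epsilon> \<le> B" using gap e lnB by (subst ln_le_cancel_iff[symmetric]) auto
          hence "ln (max (norm (X (cis t))) (9 * \<epsilon>)) \<le> ln B" using X(4)[of "cis t"] e lnB
            by (subst ln_le_cancel_iff) auto
          ultimately show ?thesis by simp
        qed
        have "0 = 2 * pi * ln (norm (X 0))" using X by simp
        also have "\<dots> \<le> integral {0..2*pi} (\<lambda>t. ln (max (norm (X (cis t))) (9 * \<epsilon>)))"
          using X e by (intro jensen_ln_max) auto
        also have "\<dots> \<le> integral {0..2*pi} (\<lambda>t. ln B - b t * (ln B - ln (9 * \<epsilon>)))"
        proof (rule integral_le)
          show "(\<lambda>t. ln (max (norm (X (cis t))) (9 * \<epsilon>))) integrable_on {0..2*pi}"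
            using X e by (intro integrable_continuous_interval ln_max_norm_continuous_circle) auto
          show "(\<lambda>t. ln B - b t * (ln B - ln (9 * \<epsilon>))) integrable_on {0..2*pi}"
            by (intro integrable_continuous_interval continuous_intros cb)
        qed (rule le)
        also have "\<dots> = 2 * pi * ln B - integral {0..2*pi} b * (ln B - ln (9 * \<epsilon>))"
          using integrable_continuous_interval[OF cb]
          by (subst integral_diff) (auto intro!: integrable_on_mult_left)
        finally have "integral {0..2*pi} b * (ln B - ln (9 * \<epsilon>)) \<le> 2 * pi * ln B" by simp
        also have "\<dots> \<le> 2 * pi * (\<eta> * (ln B - ln (9 * \<epsilon>)))" using fin by (intro mult_left_mono) auto
        also have "\<dots> = (2 * pi * \<eta>) * (ln B - ln (9 * \<epsilon>))" by simp
        finally have "integral {0..2*pi} b \<le> 2 * pi * \<eta>" using gap by (rule mult_right_le_imp_le)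
        thus ?thesis unfolding b_def[abs_def] .
      qed

    qed
  qed
qed

subsection \<open>The speed identity\<close>

definition herglotz_fps :: "complex \<Rightarrow> complex fps" where
  "herglotz_fps a = Abs_fps (\<lambda>k. if k = 0 then 1 else 2 * a ^ k)"

definition herglotz :: "complex \<Rightarrow> complex \<Rightarrow> complex" where
  "herglotz a z = (1 + a * z) / (1 - a * z)"

abbreviation geo_fps :: "complex \<Rightarrow> complex fps" where
  "geo_fps a \<equiv> Abs_fps (\<lambda>k. a ^ k)"

lemma geo_fps_eq: "geo_fps a * (1 - fps_const a * fps_X) = 1"
  by (rule fps_ext) (auto simp: fps_mult_right_const_nth right_diff_distrib fps_X_mult_right_nth mult.assoc[symmetric] power_eq_if)

lemma herglotz_fps_geo: "herglotz_fps a = 2 * geo_fps a - 1"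
  by (rule fps_ext) (auto simp: herglotz_fps_def numeral_fps_const)

text \<open>Expresses the Euler derivative as a polynomial in the geometric series, so that products
  of kernels reduce to polynomial algebra.\<close>

lemma herglotz_fps_deriv: "fps_X * fps_deriv (herglotz_fps a) = 2 * ((geo_fps a)\<^sup>2 - geo_fps a)"
proof -
  have "fps_deriv (geo_fps a) * (1 - fps_const a * fps_X) = geo_fps a * fps_const a"
    using arg_cong[OF geo_fps_eq[of a], of fps_deriv] by (simp add: algebra_simps)
  hence "fps_deriv (geo_fps a) * (geo_fps a * (1 - fps_const a * fps_X)) = (geo_fps a)\<^sup>2 * fps_const a"
    by algebra
  hence d: "fps_deriv (geo_fps a) = (geo_fps a)\<^sup>2 * fps_const a" by (simp only: geo_fps_eq mult_1_right)
  have "fps_X * fps_deriv (herglotz_fps a) = 2 * (geo_fps a * (fps_const a * fps_X * geo_fps a))"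
    by (simp add: herglotz_fps_geo d power2_eq_square algebra_simps)
  also have "fps_const a * fps_X * geo_fps a = geo_fps a - 1"
    using geo_fps_eq[of a] by (simp add: algebra_simps)
  finally show ?thesis by (simp add: power2_eq_square algebra_simps)
qed

text \<open>Everything is a polynomial in the two geometric series, and their product is reduced by
  partial fractions. Multiplied by \<open>F\<close>, the right-hand side has coefficients that are
  values of \<open>var_poly\<close> and \<open>var_poly'\<close> at \<open>a\<close> and
  \<open>b\<close>.\<close>

lemma herglotz_partial_fraction:
  assumes "a \<noteq> b"
  shows "fps_X * fps_deriv (herglotz_fps a) * herglotz_fps b =
         fps_const (- (2 * a * b) / (a - b)\<^sup>2) * (herglotz_fps a - herglotz_fps b)
         + fps_const ((a + b) / (a - b)) * (fps_X * fps_deriv (herglotz_fps a))"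
proof -
  define U W A B X where "U = geo_fps a" and "W = geo_fps b" and "A = fps_const a" and "B = fps_const b"
    and "X = (fps_X :: complex fps)"
  have U: "U * (1 - A * X) = 1" and W: "W * (1 - B * X) = 1"
    by (simp_all add: U_def W_def A_def B_def X_def geo_fps_eq)
  have *: "(A - B)\<^sup>2 * (2 * (U\<^sup>2 - U) * (2 * W - 1)) = - (2 * A * B) * ((2 * U - 1) - (2 * W - 1)) + (A\<^sup>2 - B\<^sup>2) * (2 * (U\<^sup>2 - U))"
  proof -
    have UW: "(A - B) * (U * W) = A * U - B * W" using U W by algebra
    thus ?thesis by algebra
  qed
  have ne: "fps_const ((a - b)\<^sup>2) \<noteq> 0" using assms by simp
  have c: "(A - B)\<^sup>2 = fps_const ((a - b)\<^sup>2)" "- (2 * A * B) = fps_const ((a - b)\<^sup>2) * fps_const (- (2 * a * b) / (a - b)\<^sup>2)"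
    "A\<^sup>2 - B\<^sup>2 = fps_const ((a - b)\<^sup>2) * fps_const ((a + b) / (a - b))"
  proof -
    have "fps_const (d * (x / d)) = fps_const x" if "d \<noteq> 0" for d x :: complex using that by simp
    thus "- (2 * A * B) = fps_const ((a - b)\<^sup>2) * fps_const (- (2 * a * b) / (a - b)\<^sup>2)"
      using assms by (simp add: A_def B_def numeral_fps_const)
    have "(a - b)\<^sup>2 * ((a + b) / (a - b)) = a\<^sup>2 - b\<^sup>2"
      using assms by (simp add: power2_eq_square field_simps)
    thus "A\<^sup>2 - B\<^sup>2 = fps_const ((a - b)\<^sup>2) * fps_const ((a + b) / (a - b))"
      unfolding fps_const_mult A_def B_def by (simp add: power2_eq_square)
  qed (simp add: A_def B_def power2_eq_square)
  have "fps_const ((a - b)\<^sup>2) * (2 * (U\<^sup>2 - U) * (2 * W - 1)) =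
        fps_const ((a - b)\<^sup>2) * (fps_const (- (2 * a * b) / (a - b)\<^sup>2) * ((2 * U - 1) - (2 * W - 1))
         + fps_const ((a + b) / (a - b)) * (2 * (U\<^sup>2 - U)))"
    using * unfolding c by (simp only: distrib_left mult.assoc)
  hence "2 * (U\<^sup>2 - U) * (2 * W - 1) = fps_const (- (2 * a * b) / (a - b)\<^sup>2) * ((2 * U - 1) - (2 * W - 1))
         + fps_const ((a + b) / (a - b)) * (2 * (U\<^sup>2 - U))"
    using ne by (metis mult_cancel_left)
  thus ?thesis unfolding herglotz_fps_deriv unfolding herglotz_fps_geo U_def W_def .
qed

lemma herglotz_expansion: "herglotz a has_fps_expansion herglotz_fps a"
proof -
  have "(\<lambda>z. 2 * inverse (1 - a * z) - 1) has_fps_expansion (2 * inverse (1 - fps_const a * fps_X) - 1)"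
    by (intro fps_expansion_intros) auto
  also have "inverse (1 - fps_const a * fps_X) = geo_fps a"
    using geo_fps_eq[of a] by (metis fps_inverse_unique mult.commute)
  finally have e: "(\<lambda>z. 2 * inverse (1 - a * z) - 1) has_fps_expansion herglotz_fps a"
    by (simp add: herglotz_fps_geo)
  have "open {z. 1 - a * z \<noteq> 0}" by (intro open_Collect_neq continuous_intros)
  hence "eventually (\<lambda>z. 1 - a * z \<noteq> 0) (nhds 0)"
    using eventually_nhds_in_open[of "{z. 1 - a * z \<noteq> 0}" 0] by simp
  hence "eventually (\<lambda>z. 2 * inverse (1 - a * z) - 1 = herglotz a z) (nhds 0)"
    by eventually_elim (simp add: herglotz_def field_simps)
  from has_fps_expansion_cong[OF this refl] e show ?thesis by blast
qed

text \<open>\<open>var_poly n a w\<close> is the \<open>n\<close>-th coefficient of \<open>f\<close> times the Herglotz kernel with pole at \<open>1 / w\<close>, where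
  \<open>a\<close> are the coefficients of \<open>f\<close>; its real part on the circle is the first variation of the
  functional under adding mass at \<open>w\<close>. Its derivative, multiplied by \<open>w\<close>, is \<open>var_poly'\<close>.\<close>

definition var_poly :: "nat \<Rightarrow> (nat \<Rightarrow> complex) \<Rightarrow> complex \<Rightarrow> complex" where
  "var_poly n a w = 2 * (\<Sum>k\<le>n. a (n - k) * w ^ k) - a n"

definition var_poly' :: "nat \<Rightarrow> (nat \<Rightarrow> complex) \<Rightarrow> complex \<Rightarrow> complex" where
  "var_poly' n a w = 2 * (\<Sum>k\<le>n. of_nat k * a (n - k) * w ^ k)"

lemma fps_mult_nth_rev:
  fixes F G :: "complex fps"
  shows "fps_nth (F * G) n = (\<Sum>k\<le>n. fps_nth F (n - k) * fps_nth G k)"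
  unfolding mult.commute[of F G] fps_mult_nth
  by (auto simp: atMost_atLeast0 mult.commute intro!: sum.cong)

lemma fps_X_deriv_nth: "fps_nth (fps_X * fps_deriv (F :: complex fps)) k = of_nat k * fps_nth F k"
  by (cases k) (simp_all add: fps_X_mult_nth)

lemma var_poly_fps: "fps_nth (F * herglotz_fps w) n = var_poly n (fps_nth F) w"
proof -
  have "fps_nth (F * herglotz_fps w) n = (\<Sum>k\<le>n. 2 * (fps_nth F (n - k) * w ^ k) - (if k = 0 then fps_nth F n else 0))"
    unfolding fps_mult_nth_rev by (intro sum.cong) (auto simp: herglotz_fps_def)
  also have "\<dots> = var_poly n (fps_nth F) w"
    by (simp add: var_poly_def sum_subtractf sum_distrib_left)
  finally show ?thesis .
qed

lemma var_poly'_fps: "fps_nth (F * (fps_X * fps_deriv (herglotz_fps w))) n = var_poly' n (fps_nth F) w"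
  unfolding var_poly'_def sum_distrib_left by (subst fps_mult_nth_rev, intro sum.cong) (auto simp: herglotz_fps_def fps_X_deriv_nth)

text \<open>The Euler derivative weights the coefficient of index \<open>n - k\<close> by
  \<open>n - k\<close>; the part with weight \<open>n\<close> gives \<open>var_poly\<close> and the
  part with weight \<open>k\<close> gives \<open>var_poly'\<close>.\<close>

lemma var_poly_deriv_fps:
  "fps_nth (fps_X * fps_deriv F * herglotz_fps w) n = of_nat n * var_poly n (fps_nth F) w - var_poly' n (fps_nth F) w"
proof -
  have "fps_nth (fps_X * fps_deriv F * herglotz_fps w) n
      = (\<Sum>k\<le>n. (of_nat n - of_nat k) * (fps_nth F (n - k) * (if k = 0 then 1 else 2 * w ^ k)))"
  proof (subst fps_mult_nth_rev, intro sum.cong refl)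
    fix k assume "k \<in> {..n}"
    thus "fps_nth (fps_X * fps_deriv F) (n - k) * fps_nth (herglotz_fps w) k
        = (of_nat n - of_nat k) * (fps_nth F (n - k) * (if k = 0 then 1 else 2 * w ^ k))"
      unfolding fps_X_deriv_nth by (simp add: herglotz_fps_def of_nat_diff)
  qed
  also have "\<dots> = (\<Sum>k\<le>n. of_nat n * (2 * (fps_nth F (n - k) * w ^ k) - (if k = 0 then fps_nth F n else 0))
                    - 2 * (of_nat k * fps_nth F (n - k) * w ^ k))"
    by (intro sum.cong) (auto simp: algebra_simps)
  also have "\<dots> = of_nat n * var_poly n (fps_nth F) w - var_poly' n (fps_nth F) w"
    by (simp add: var_poly_def var_poly'_def sum_subtractf sum_distrib_left[symmetric])
  finally show ?thesis .
qed

lemma var_poly_has_vector_derivative: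
  "((\<lambda>t. var_poly n a (cis t)) has_vector_derivative \<i> * var_poly' n a (cis t)) (at t)"
proof -
  have d: "((\<lambda>t. cis t ^ k) has_vector_derivative of_nat k * \<i> * cis t ^ k) (at t)" for k
  proof -
    have "((\<lambda>t. cis (real k * t)) has_vector_derivative of_real (real k) * \<i> * cis (real k * t)) (at t)"
      unfolding has_vector_derivative_complex_iff
      by (auto intro!: derivative_eq_intros)
    thus ?thesis by (simp only: Complex.DeMoivre of_real_of_nat_eq)
  qed
  show ?thesis unfolding var_poly_def var_poly'_def
    by (rule has_vector_derivative_eq_rhs, (rule derivative_intros d)+)
       (simp add: sum_distrib_left mult_ac)
qed


text \<open>The differential equation is multiplied by \<open>fps_X\<close> and by the kernel at
  \<open>b\<close>, and the \<open>n\<close>-th coefficient is expanded in partial fractions. In the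
  real part the terms at the atoms drop out by \<open>T0\<close> and \<open>T1\<close>, and what
  remains at \<open>b\<close> has exactly the weights of the speed.\<close>

lemma speed_identity:
  fixes F :: "complex fps" and lam :: "nat \<Rightarrow> real" and al :: "nat \<Rightarrow> complex"
  assumes ode: "fps_deriv F = - F * fps_deriv (\<Sum>j<N. fps_const (of_real (lam j)) * herglotz_fps (al j))"
    and al: "\<And>j. j < N \<Longrightarrow> norm (al j) = 1"
    and T0: "\<And>j. j < N \<Longrightarrow> Re (var_poly n (fps_nth F) (al j)) = 0"
    and T1: "\<And>j. j < N \<Longrightarrow> Im (var_poly' n (fps_nth F) (al j)) = 0"
    and b: "norm b = 1" "b \<notin> al ` {..<N}"
  shows "Re (var_poly' n (fps_nth F) b) =
         (real n - atom_speed N lam al b) * Re (var_poly n (fps_nth F) b)"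
proof -
  let ?a = "fps_nth F" and ?H = herglotz_fps
  let ?D = "\<lambda>j. fps_X * fps_deriv (?H (al j))"
  define k where "k j = - (2 * al j * b) / (al j - b)\<^sup>2" for j
  define c where "c j = (al j + b) / (al j - b)" for j
  have expand: "- F * (l * (\<kappa> * (G - H) + \<gamma> * D)) = - l * (\<kappa> * (F * G - F * H) + \<gamma> * (F * D))"
    for l \<kappa> \<gamma> G H D :: "complex fps"
    by (simp add: algebra_simps)
  have "of_nat n * var_poly n ?a b - var_poly' n ?a b = fps_nth (fps_X * fps_deriv F * ?H b) n"
    by (rule var_poly_deriv_fps [symmetric])
  also have "fps_X * fps_deriv F * ?H b = - F * (\<Sum>j<N. fps_const (of_real (lam j)) * (?D j * ?H b))"
    unfolding ode by (simp add: fps_deriv_sum sum_distrib_left sum_distrib_right mult_ac)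
  also have "\<dots> = (\<Sum>j<N. fps_const (- of_real (lam j)) *
      (fps_const (k j) * (F * ?H (al j) - F * ?H b) + fps_const (c j) * (F * ?D j)))"
    unfolding sum_distrib_left
  proof (intro sum.cong refl)
    fix j assume "j \<in> {..<N}"
    hence "al j \<noteq> b" using b by auto
    show "- F * (fps_const (of_real (lam j)) * (?D j * ?H b)) = fps_const (- of_real (lam j)) *
      (fps_const (k j) * (F * ?H (al j) - F * ?H b) + fps_const (c j) * (F * ?D j))"
      unfolding herglotz_partial_fraction[OF \<open>al j \<noteq> b\<close>] k_def c_def fps_const_neg[symmetric]
      by (rule expand)
  qed
  also have "fps_nth \<dots> n = (\<Sum>j<N. - of_real (lam j) *
      (k j * (var_poly n ?a (al j) - var_poly n ?a b) + c j * var_poly' n ?a (al j)))"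
    by (simp add: fps_sum_nth var_poly_fps var_poly'_fps)
  finally have "Re (of_nat n * var_poly n ?a b - var_poly' n ?a b) = (\<Sum>j<N. Re (- of_real (lam j) *
      (k j * (var_poly n ?a (al j) - var_poly n ?a b) + c j * var_poly' n ?a (al j))))"
    by simp
  also have "\<dots> = (\<Sum>j<N. 2 * lam j / (norm (b - al j))\<^sup>2 * Re (var_poly n ?a b))"
  proof (intro sum.cong refl)
    fix j assume "j \<in> {..<N}"
    hence j: "j < N" and ne: "al j \<noteq> b" using b by auto
    have aa: "al j * cnj (al j) = 1" "b * cnj b = 1" using al[OF j] b(1) by (simp_all add: complex_norm_square[symmetric])
    have nz: "al j \<noteq> 0" "b \<noteq> 0" using aa by auto
    \<comment> \<open>On the circle conjugation is inversion; this makes \<open>k j\<close> a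
      positive real number and \<open>c j\<close> purely imaginary.\<close>
    have inv: "cnj (al j) = 1 / al j" "cnj b = 1 / b" using aa nz by (auto simp: field_simps)
    have "of_real ((norm (b - al j))\<^sup>2) = (b - al j) * cnj (b - al j)" by (simp only: complex_norm_square)
    also have "\<dots> = (b - al j) * (1 / b - 1 / al j)" by (simp add: inv)
    also have "\<dots> = - (al j - b)\<^sup>2 / (al j * b)" using nz by (simp add: power2_eq_square field_simps)
    finally have n2: "of_real ((norm (b - al j))\<^sup>2) = - (al j - b)\<^sup>2 / (al j * b)" .
    have k: "k j = of_real (2 / (norm (b - al j))\<^sup>2)"
      unfolding k_def of_real_divide n2 using nz ne by (simp add: field_simps)
    have "cnj (c j) = - c j"
      using nz ne unfolding c_def by (simp add: inv divide_simps) (simp add: algebra_simps)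
    hence c: "Re (c j) = 0" by (simp add: complex_eq_iff)
    show "Re (- of_real (lam j) * (k j * (var_poly n ?a (al j) - var_poly n ?a b) + c j * var_poly' n ?a (al j)))
        = 2 * lam j / (norm (b - al j))\<^sup>2 * Re (var_poly n ?a b)"
      unfolding k using T0[OF j] T1[OF j] c by simp
  qed
  also have "\<dots> = atom_speed N lam al b * Re (var_poly n ?a b)"
    by (simp only: sum_distrib_right atom_speed_def)
  finally show ?thesis by (simp add: algebra_simps)
qed

subsection \<open>Coefficients and first variation\<close>

lemma circle_coeff:
  assumes "f holomorphic_on cball 0 r" "0 < r"
  shows "((\<lambda>t. f (of_real r * cis t) * cis (- (real k * t))) has_integral
           2 * of_real pi * (of_real r ^ k * ((deriv ^^ k) f 0 / fact k))) {0..2*pi}"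
proof -
  have c: "((\<lambda>u. f u / (u - 0) ^ Suc k) has_contour_integral ((2 * pi * \<i>) / fact k * (deriv ^^ k) f 0)) (circlepath 0 r)"
    using assms by (intro Cauchy_has_contour_integral_higher_derivative_circlepath)
                   (auto intro: holomorphic_on_imp_continuous_on holomorphic_on_subset)
  have "((\<lambda>t. f (of_real r * cis t) / (of_real r * cis t) ^ Suc k * r * \<i> * cis t)
            has_integral ((2 * pi * \<i>) / fact k * (deriv ^^ k) f 0)) {0..2*pi}"
    using c unfolding circlepath_def by (subst (asm) has_contour_integral_part_circlepath_iff) simp_all
  from has_integral_mult_right[OF this, of "of_real r ^ k / \<i>"]
  have i: "((\<lambda>t. of_real r ^ k / \<i> * (f (of_real r * cis t) / (of_real r * cis t) ^ Suc k * r * \<i> * cis t))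
          has_integral of_real r ^ k / \<i> * ((2 * pi * \<i>) / fact k * (deriv ^^ k) f 0)) {0..2*pi}" .
  have "of_real r ^ k / \<i> * (f (of_real r * cis t) / (of_real r * cis t) ^ Suc k * r * \<i> * cis t)
      = f (of_real r * cis t) * cis (- (real k * t))" for t
  proof -
    have "cis (- (real k * t)) = 1 / cis t ^ k"
      by (simp only: Complex.DeMoivre cis_inverse[symmetric] inverse_eq_divide)
    thus ?thesis using assms(2) by (simp add: power_mult_distrib field_simps)
  qed
  moreover have "of_real r ^ k / \<i> * ((2 * pi * \<i>) / fact k * (deriv ^^ k) f 0)
      = 2 * of_real pi * (of_real r ^ k * ((deriv ^^ k) f 0 / fact k))"
    by (simp add: field_simps)
  ultimately show ?thesis using i by (simp only:)
qed

text \<open>By induction on the degree: the cross term with the new top coefficient is the real part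
  of a polynomial without constant term, hence has mean 0.\<close>

lemma parseval_trig:
  fixes c :: "nat \<Rightarrow> complex"
  shows "((\<lambda>t. (norm (\<Sum>k\<le>n. c k * cis t ^ k))\<^sup>2) has_integral 2 * pi * (\<Sum>k\<le>n. (norm (c k))\<^sup>2)) {0..2*pi}"
proof (induction n)
  case 0
  show ?case using has_integral_const_real[of "(norm (c 0))\<^sup>2" 0 "2 * pi"] by simp
next
  case (Suc n)
  define g where "g z = c (Suc n) * (\<Sum>k\<le>n. cnj (c k) * z ^ (Suc n - k))" for z
  have "((\<lambda>t. g (of_real 1 * cis t)) has_integral 2 * of_real pi * g 0) {0..2*pi}"
    unfolding g_def by (rule circle_mean) (intro holomorphic_intros, simp)
  moreover have "g 0 = 0" unfolding g_def by (simp add: power_0_left Suc_diff_le)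
  ultimately have "((\<lambda>t. g (cis t)) has_integral 0) {0..2*pi}" by simp
  from has_integral_linear[OF this bounded_linear_Re]
  have gi: "((\<lambda>t. Re (g (cis t))) has_integral 0) {0..2*pi}" by (simp add: o_def)
  have eq: "(norm (\<Sum>k\<le>Suc n. c k * cis t ^ k))\<^sup>2
      = (norm (\<Sum>k\<le>n. c k * cis t ^ k))\<^sup>2 + (norm (c (Suc n)))\<^sup>2 + 2 * Re (g (cis t))" for t
  proof -
    let ?S = "\<Sum>k\<le>n. c k * cis t ^ k" and ?y = "c (Suc n) * cis t ^ Suc n"
    have "(norm (x + y))\<^sup>2 = (norm x)\<^sup>2 + (norm y)\<^sup>2 + 2 * Re (y * cnj x)" for x y :: complex
      unfolding cmod_power2 by (simp add: power2_eq_square algebra_simps)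
    hence "(norm (?S + ?y))\<^sup>2 = (norm ?S)\<^sup>2 + (norm ?y)\<^sup>2 + 2 * Re (?y * cnj ?S)" .
    also have "(norm ?y)\<^sup>2 = (norm (c (Suc n)))\<^sup>2" by (simp add: norm_mult norm_power)
    also have "?y * cnj ?S = g (cis t)"
    proof -
      have "cis t ^ Suc n * cnj (cis t) ^ k = cis t ^ (Suc n - k)" if "k \<le> n" for k
      proof -
        have "cis t ^ Suc n = cis t ^ (Suc n - k) * cis t ^ k" using that by (simp flip: power_add)
        moreover have "cis t ^ k * cnj (cis t) ^ k = 1" by (simp add: cis_cnj cis_mult flip: power_mult_distrib)
        ultimately show ?thesis by (simp add: mult.assoc)
      qed
      thus ?thesis unfolding g_def cnj_sum sum_distrib_left
        by (intro sum.cong) (auto simp: mult_ac)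
    qed
    finally show ?thesis by simp
  qed
  have "((\<lambda>t. (norm (\<Sum>k\<le>n. c k * cis t ^ k))\<^sup>2 + (norm (c (Suc n)))\<^sup>2 + 2 * Re (g (cis t)))
      has_integral 2 * pi * (\<Sum>k\<le>n. (norm (c k))\<^sup>2) + (norm (c (Suc n)))\<^sup>2 * (2 * pi) + 2 * 0) {0..2*pi}"
    using has_integral_const_real[of "(norm (c (Suc n)))\<^sup>2" 0 "2 * pi"]
    by (intro has_integral_add Suc has_integral_mult_right gi) (simp add: mult_ac)
  thus ?case unfolding eq by (simp add: algebra_simps)
qed

text \<open>Bessel's inequality: on the circle of radius \<open>r\<close> the mean square distance
  of \<open>f\<close> from its Taylor sum is non-negative; then \<open>r\<close> tends to 1.\<close>

lemma coeff_square_sum_le_1: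
  assumes f: "f holomorphic_on ball 0 1" "\<And>z. z \<in> ball 0 1 \<Longrightarrow> norm (f z) \<le> 1"
  shows "(\<Sum>k\<le>n. (norm ((deriv ^^ k) f 0 / fact k))\<^sup>2) \<le> 1"
proof -
  define a where "a k = (deriv ^^ k) f 0 / fact k" for k
  have le: "(\<Sum>k\<le>n. (norm (a k))\<^sup>2 * r ^ (2 * k)) \<le> 1" if r: "0 < r" "r < 1" for r :: real
  proof -
    define c where "c k = a k * of_real r ^ k" for k
    define S where "S t = (\<Sum>k\<le>n. c k * cis t ^ k)" for t
    define A where "A = (\<Sum>k\<le>n. (norm (c k))\<^sup>2)"
    have hol: "f holomorphic_on cball 0 r" using f(1) r by (auto intro: holomorphic_on_subset)
    have "((\<lambda>t. \<Sum>k\<le>n. cnj (c k) * (f (of_real r * cis t) * cis (- (real k * t)))) has_integral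
        (\<Sum>k\<le>n. cnj (c k) * (2 * of_real pi * (of_real r ^ k * a k)))) {0..2*pi}"
      unfolding a_def by (intro has_integral_sum has_integral_mult_right circle_coeff hol r) auto
    also have "(\<lambda>t. \<Sum>k\<le>n. cnj (c k) * (f (of_real r * cis t) * cis (- (real k * t)))) = (\<lambda>t. f (of_real r * cis t) * cnj (S t))"
    proof
      fix t
      have "cnj (cis t ^ k) = cis (- (real k * t))" for k by (simp only: Complex.DeMoivre cis_cnj)
      thus "(\<Sum>k\<le>n. cnj (c k) * (f (of_real r * cis t) * cis (- (real k * t)))) = f (of_real r * cis t) * cnj (S t)"
        unfolding S_def cnj_sum sum_distrib_left by (intro sum.cong) (auto simp: mult_ac simp del: complex_cnj_power)
    qed
    also have "(\<Sum>k\<le>n. cnj (c k) * (2 * of_real pi * (of_real r ^ k * a k))) = of_real (2 * pi * A)"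
    proof -
      have "cnj (c k) * (2 * of_real pi * (of_real r ^ k * a k)) = of_real (2 * pi * (norm (c k))\<^sup>2)" for k
        unfolding of_real_mult complex_norm_square by (simp add: c_def)
      thus ?thesis by (simp only: A_def sum_distrib_left of_real_sum)
    qed
    finally have "((\<lambda>t. f (of_real r * cis t) * cnj (S t)) has_integral of_real (2 * pi * A)) {0..2*pi}" .
    from has_integral_linear[OF this bounded_linear_Re]
    have i1: "((\<lambda>t. Re (f (of_real r * cis t) * cnj (S t))) has_integral 2 * pi * A) {0..2*pi}"
      by (simp add: o_def)
    have i2: "((\<lambda>t. (norm (S t))\<^sup>2) has_integral 2 * pi * A) {0..2*pi}"
      unfolding S_def A_def by (rule parseval_trig)
    have i3: "((\<lambda>t. 1 - 2 * Re (f (of_real r * cis t) * cnj (S t)) + (norm (S t))\<^sup>2) has_integral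
        1 * (2 * pi) - 2 * (2 * pi * A) + 2 * pi * A) {0..2*pi}"
      using has_integral_const_real[of "1::real" 0 "2 * pi"]
      by (intro has_integral_add has_integral_diff has_integral_mult_right i1 i2) auto
    have "0 \<le> 1 * (2 * pi) - 2 * (2 * pi * A) + 2 * pi * A"
    proof (rule has_integral_nonneg[OF i3])
      fix t
      let ?f = "f (of_real r * cis t)"
      have "0 \<le> (norm (?f - S t))\<^sup>2" by simp
      also have "\<dots> = (norm ?f)\<^sup>2 - 2 * Re (?f * cnj (S t)) + (norm (S t))\<^sup>2"
        unfolding cmod_power2 by (simp add: power2_eq_square algebra_simps)
      also have "(norm ?f)\<^sup>2 \<le> 1" using f(2)[of "of_real r * cis t"] r
        by (simp add: norm_mult power_le_one)
      finally show "0 \<le> 1 - 2 * Re (?f * cnj (S t)) + (norm (S t))\<^sup>2" by simp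
    qed
    hence "A \<le> 1" by simp
    thus ?thesis using r by (simp add: A_def c_def norm_mult norm_power power_mult_distrib power_mult mult.commute[of 2])
  qed
  have "((\<lambda>r. \<Sum>k\<le>n. (norm (a k))\<^sup>2 * r ^ (2 * k)) \<longlongrightarrow> (\<Sum>k\<le>n. (norm (a k))\<^sup>2 * 1 ^ (2 * k))) (at_left 1)"
    by (intro tendsto_intros)
  moreover have "\<forall>\<^sub>F r in at_left 1. (\<Sum>k\<le>n. (norm (a k))\<^sup>2 * r ^ (2 * k)) \<le> 1"
    using eventually_at_left_real[of 0 "1::real"] by (auto elim!: eventually_mono intro: le)
  ultimately have "(\<Sum>k\<le>n. (norm (a k))\<^sup>2 * 1 ^ (2 * k)) \<le> 1"
    by (intro tendsto_upperbound) auto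
  thus ?thesis by (simp add: a_def)
qed

section \<open>Competitors and variations of an extremal function\<close>

lemma B0_expansion:
  assumes "f \<in> B0"
  shows "f has_fps_expansion fps_expansion f 0"
  using assms by (intro has_fps_expansion_fps_expansion[of "ball 0 1"]) (auto simp: B0_def)

lemma Mfun_fps:
  assumes "f has_fps_expansion F"
  shows "Mfun n f = Re (fps_nth F n)"
  using fps_nth_fps_expansion[OF assms, of n] by (simp add: Mfun_def)

text \<open>The competitor \<open>(1 + z ^ n) / 2\<close> lies in \<open>B0\<close> and has
  \<open>n\<close>-th coefficient \<open>1 / 2\<close>.\<close>

lemma extremal_coeff_ge_half:
  assumes "extremal n f" "1 \<le> n" "f has_fps_expansion F"
  shows "1 / 2 \<le> Re (fps_nth F n)"
proof -
  let ?a = "fps_nth F n"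
  have fB: "f \<in> B0" and max: "\<And>g. g \<in> B0 \<Longrightarrow> Mfun n g \<le> Re ?a"
    using assms Mfun_fps[OF assms(3)] by (auto simp: extremal_def)
  define g :: "complex \<Rightarrow> complex" where "g z = (1 / 2) * (1 + z ^ n)" for z
  have "g \<in> B0"
  proof -
    have "0 < norm (g z) \<and> norm (g z) \<le> 1" if "z \<in> ball 0 1" for z
    proof -
      have lt: "norm (z ^ n) < 1" using that assms(2) by (simp add: norm_power power_less_one_iff)
      hence "1 + z ^ n \<noteq> 0" by (metis add.inverse_inverse add_eq_0_iff less_irrefl norm_minus_cancel norm_one)
      moreover have "norm (1 + z ^ n) \<le> 2" using norm_triangle_ineq[of 1 "z ^ n"] lt by simp
      ultimately show ?thesis by (simp add: g_def norm_mult)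
    qed
    thus ?thesis unfolding B0_def g_def by (auto intro!: holomorphic_intros)
  qed
  moreover have "g has_fps_expansion fps_const (1 / 2) * (1 + fps_X ^ n)"
    unfolding g_def by (intro fps_expansion_intros)
  hence "Mfun n g = 1 / 2" using assms(2) by (subst Mfun_fps) (auto simp: fps_X_power_nth)
  ultimately show ?thesis using max by force
qed

text \<open>The competitor \<open>f * exp (- t * h)\<close> equals \<open>f - t * f * h\<close> up
  to a remainder of order \<open>t\<^sup>2\<close> on the disc of radius \<open>1 / 2\<close>, where
  Cauchy's inequality controls its \<open>n\<close>-th coefficient. Extremality, division by
  \<open>t\<close> and \<open>t \<rightarrow> 0\<close> give the sign.\<close>

lemma first_variation:
  assumes ext: "extremal n f" and F: "f has_fps_expansion F"
    and h: "h holomorphic_on ball 0 1" "h has_fps_expansion H"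
    and \<delta>: "0 < \<delta>" "\<And>t. 0 < t \<Longrightarrow> t < \<delta> \<Longrightarrow> (\<lambda>z. f z * exp (- of_real t * h z)) \<in> B0"
  shows "0 \<le> Re (fps_nth (F * H) n)"
proof -
  have fB: "f \<in> B0" and max: "\<And>g. g \<in> B0 \<Longrightarrow> Mfun n g \<le> Re (fps_nth F n)"
    using ext Mfun_fps[OF F] by (auto simp: extremal_def)
  have fhol: "f holomorphic_on ball 0 1" using fB by (simp add: B0_def)
  have "compact (h ` cball 0 (1/2))"
    using h(1) by (intro compact_continuous_image holomorphic_on_imp_continuous_on) (auto intro: holomorphic_on_subset)
  then obtain K where K: "K > 0" "\<And>z. z \<in> cball 0 (1/2) \<Longrightarrow> norm (h z) \<le> K"
    by (metis bounded_pos compact_imp_bounded imageI)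
  define C where "C = exp K * K\<^sup>2 / (1/2) ^ n"
  have bound: "- (C * t) \<le> Re (fps_nth (F * H) n)" if t: "0 < t" "t < min \<delta> 1" for t
  proof -
    define g where "g z = f z * exp (- of_real t * h z)" for z
    have gB: "g \<in> B0" unfolding g_def[abs_def] using \<delta>(2)[of t] t by simp
    define G where "G = fps_expansion g 0"
    have G: "g has_fps_expansion G" unfolding G_def using gB by (rule B0_expansion)
    define R where "R z = g z - f z + of_real t * (f z * h z)" for z
    have Rexp: "R has_fps_expansion (G - F + fps_const (of_real t) * (F * H))"
      unfolding R_def by (intro fps_expansion_intros G F h)
    have Rhol: "R holomorphic_on ball 0 1" unfolding R_def g_def by (intro holomorphic_intros fhol h)
    have "norm ((deriv ^^ n) R 0) \<le> fact n * (t\<^sup>2 * (exp K * K\<^sup>2)) / (1/2) ^ n"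
    proof (rule Cauchy_inequality)
      show "R holomorphic_on ball 0 (1/2)" using Rhol by (rule holomorphic_on_subset) auto
      show "continuous_on (cball 0 (1/2)) R"
        using Rhol by (intro holomorphic_on_imp_continuous_on) (auto intro: holomorphic_on_subset)
      fix z :: complex assume "norm (0 - z) = 1/2"
      hence z: "z \<in> cball 0 (1/2)" "z \<in> ball 0 1" by auto
      define w where "w = - of_real t * h z"
      have nw: "norm w \<le> t * K" using K(2)[OF z(1)] t by (simp add: w_def norm_mult)
      hence nw': "norm w \<le> K" using t K(1) mult_right_mono[of t 1 K] by linarith
      have "norm (exp w - (\<Sum>i\<le>1. w ^ i / fact i)) \<le> exp (norm w) * (norm w ^ Suc 1) / fact 1"
        by (rule Taylor_exp_field)
      also have "\<dots> = exp (norm w) * (norm w)\<^sup>2" by (simp add: power2_eq_square)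
      also have "\<dots> \<le> exp K * (t * K)\<^sup>2" using nw nw' by (intro mult_mono power_mono) auto
      finally have e: "norm (exp w - 1 - w) \<le> t\<^sup>2 * (exp K * K\<^sup>2)"
        by (simp add: power_mult_distrib algebra_simps)
      have "R z = f z * (exp w - 1 - w)" by (simp add: R_def g_def w_def algebra_simps)
      hence "norm (R z) = norm (f z) * norm (exp w - 1 - w)" by (simp add: norm_mult)
      also have "\<dots> \<le> 1 * (t\<^sup>2 * (exp K * K\<^sup>2))"
        using fB z e by (intro mult_mono) (auto simp: B0_def)
      finally show "norm (R z) \<le> t\<^sup>2 * (exp K * K\<^sup>2)" by simp
    qed simp
    hence nR: "norm (fps_nth (G - F + fps_const (of_real t) * (F * H)) n) \<le> t\<^sup>2 * C"
      unfolding fps_nth_fps_expansion[OF Rexp] by (simp add: norm_divide C_def field_simps)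
    have "Re (fps_nth G n) \<le> Re (fps_nth F n)" using max[OF gB] Mfun_fps[OF G] by simp
    moreover have "Re (fps_nth (G - F + fps_const (of_real t) * (F * H)) n)
        = Re (fps_nth G n) - Re (fps_nth F n) + t * Re (fps_nth (F * H) n)" by simp
    moreover have "- (t\<^sup>2 * C) \<le> Re (fps_nth (G - F + fps_const (of_real t) * (F * H)) n)"
      using nR abs_Re_le_cmod[of "fps_nth (G - F + fps_const (of_real t) * (F * H)) n"] by linarith
    ultimately have "- (t\<^sup>2 * C) \<le> t * Re (fps_nth (F * H) n)" by linarith
    hence "t * (- (C * t)) \<le> t * Re (fps_nth (F * H) n)" by (simp add: power2_eq_square mult_ac)
    thus ?thesis using t(1) by (rule mult_left_le_imp_le)
  qed
  have "((\<lambda>t. - (C * t)) \<longlongrightarrow> - (C * 0)) (at_right 0)" by (intro tendsto_intros)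
  moreover have "\<forall>\<^sub>F t in at_right 0. - (C * t) \<le> Re (fps_nth (F * H) n)"
    using eventually_at_right_real[of 0 "min \<delta> 1"] \<delta>(1) by (auto elim!: eventually_mono intro!: bound)
  ultimately show ?thesis by (intro tendsto_upperbound[where f = "\<lambda>t. - (C * t)" and F = "at_right 0"]) auto
qed

subsection \<open>Integration by parts\<close>

lemma norm_cis_diff_power2: "(norm (cis t - cis \<tau>))\<^sup>2 = 2 - 2 * cos (t - \<tau>)"
proof -
  have "(norm (cis t - cis \<tau>))\<^sup>2 = (cos t)\<^sup>2 + (sin t)\<^sup>2 + ((cos \<tau>)\<^sup>2 + (sin \<tau>)\<^sup>2) - 2 * cos (t - \<tau>)"
    unfolding cmod_power2 cos_diff by (simp add: power2_eq_square algebra_simps)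
  thus ?thesis by simp
qed

text \<open>The derivative of \<open>1 / (\<omega> + \<nu>)\<close> for a single atom of mass \<open>l\<close> at \<open>cis \<tau>\<close>.\<close>

definition atom_osc :: "real \<Rightarrow> real \<Rightarrow> real \<Rightarrow> real \<Rightarrow> real" where
  "atom_osc \<nu> l \<tau> t = 2 * l * (2 * sin (t - \<tau>)) / (2 * l + \<nu> * (2 - 2 * cos (t - \<tau>)))\<^sup>2"

lemma atom_osc_denominator_pos:
  fixes l \<nu> x :: real
  assumes "0 < l" "0 < \<nu>"
  shows "0 < 2 * l + \<nu> * (2 - 2 * cos x)"
  using assms by (intro add_pos_nonneg mult_nonneg_nonneg) auto

lemma atom_osc_integrable:
  assumes "0 < l" "0 < \<nu>"
  shows "(\<lambda>t. \<bar>atom_osc \<nu> l \<tau> t\<bar>) integrable_on {a..b}"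
proof (rule integrable_continuous_interval)
  have "2 * l + \<nu> * (2 - 2 * cos (t - \<tau>)) \<noteq> 0" for t
    using atom_osc_denominator_pos[OF assms, of "t - \<tau>"] by simp
  thus "continuous_on {a..b} (\<lambda>t. \<bar>atom_osc \<nu> l \<tau> t\<bar>)"
    unfolding atom_osc_def by (intro continuous_intros) auto
qed

text \<open>The primitive \<psi> is \<open>1 / (\<omega> + \<nu>)\<close> for one atom, written
  without a singularity at the atom. It is monotone where the sine keeps its sign and takes values
  between 0 and \<open>1 / \<nu>\<close>.\<close>

lemma atom_osc_monotone_piece:
  assumes l: "0 < l" "0 < \<nu>" and ab: "a \<le> b"
    and sgn: "\<And>t. t \<in> {a..b} \<Longrightarrow> 0 \<le> s * sin (t - \<tau>)" and s: "\<bar>s\<bar> = 1"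
  shows "integral {a..b} (\<lambda>t. \<bar>atom_osc \<nu> l \<tau> t\<bar>) \<le> 1 / \<nu>"
proof -
  define D where "D t = 2 - 2 * cos (t - \<tau>)" for t
  define \<psi> where "\<psi> t = D t / (2 * l + \<nu> * D t)" for t
  have pos: "0 < 2 * l + \<nu> * D t" for t
    unfolding D_def by (rule atom_osc_denominator_pos[OF l])
  have \<psi>01: "0 \<le> \<psi> t" "\<psi> t \<le> 1 / \<nu>" for t
  proof -
    have "0 \<le> D t" by (simp add: D_def)
    thus "0 \<le> \<psi> t" using pos[of t] by (simp add: \<psi>_def)
    show "\<psi> t \<le> 1 / \<nu>" using pos[of t] l by (simp add: \<psi>_def field_simps)
  qed
  have "(\<psi> has_real_derivative atom_osc \<nu> l \<tau> t) (at t within {a..b})" for t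
    unfolding \<psi>_def D_def
    by (rule derivative_eq_intros refl)+
       (use pos[of t] in \<open>auto simp: D_def atom_osc_def power2_eq_square algebra_simps\<close>)
  hence "(atom_osc \<nu> l \<tau> has_integral \<psi> b - \<psi> a) {a..b}"
    using ab by (intro fundamental_theorem_of_calculus)
                (simp_all add: has_real_derivative_iff_has_vector_derivative)
  hence "((\<lambda>t. s * atom_osc \<nu> l \<tau> t) has_integral s * (\<psi> b - \<psi> a)) {a..b}"
    by (rule has_integral_mult_right)
  moreover have "s * atom_osc \<nu> l \<tau> t = \<bar>atom_osc \<nu> l \<tau> t\<bar>" if "t \<in> {a..b}" for t
  proof -
    have "s * atom_osc \<nu> l \<tau> t = 4 * l * (s * sin (t - \<tau>)) / (2 * l + \<nu> * D t)\<^sup>2"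
      by (simp add: atom_osc_def D_def)
    moreover have "0 \<le> 4 * l * (s * sin (t - \<tau>)) / (2 * l + \<nu> * D t)\<^sup>2"
      using sgn[OF that] l by (intro divide_nonneg_nonneg mult_nonneg_nonneg[of "4 * l"]) auto
    ultimately have "s * atom_osc \<nu> l \<tau> t = \<bar>s * atom_osc \<nu> l \<tau> t\<bar>" by (simp only: abs_of_nonneg)
    thus ?thesis using s by (simp add: abs_mult)
  qed
  ultimately have "((\<lambda>t. \<bar>atom_osc \<nu> l \<tau> t\<bar>) has_integral s * (\<psi> b - \<psi> a)) {a..b}"
    by (rule has_integral_eq[rotated])
  moreover have "s * (\<psi> b - \<psi> a) \<le> 1 / \<nu>"
    using \<psi>01[of a] \<psi>01[of b] s by (auto simp: abs_if split: if_splits)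
  ultimately show ?thesis by (simp add: integral_unique)
qed

text \<open>One period consists of a rising and a falling piece; cutting it at angle 0 rather than
  at the atom can produce a third piece.\<close>

lemma atom_osc_total:
  assumes l: "0 < l" "0 < \<nu>" and \<tau>: "0 \<le> \<tau>" "\<tau> < 2 * pi"
  shows "integral {0..2*pi} (\<lambda>t. \<bar>atom_osc \<nu> l \<tau> t\<bar>) \<le> 3 / \<nu>"
proof -
  \<comment> \<open>Shifting by pi flips the sine, so an atom in the second half of the circle is
    treated as one in the first half, with the sign kept in \<open>s\<close>.\<close>
  obtain \<sigma> s :: real where \<sigma>: "0 \<le> \<sigma>" "\<sigma> < pi" "\<bar>s\<bar> = 1" "\<And>t. sin (t - \<tau>) = s * sin (t - \<sigma>)"
  proof (cases "\<tau> < pi")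
    case True
    thus ?thesis using that[of \<tau> 1] \<tau> by simp
  next
    case False
    have "sin (t - \<tau>) = - 1 * sin (t - (\<tau> - pi))" for t
    proof -
      have "sin (t - (\<tau> - pi)) = sin ((t - \<tau>) + pi)" by (simp add: algebra_simps)
      thus ?thesis by simp
    qed
    thus ?thesis using that[of "\<tau> - pi" "-1"] False \<tau> by simp
  qed
  let ?I = "\<lambda>a b. integral {a..b} (\<lambda>t. \<bar>atom_osc \<nu> l \<tau> t\<bar>)"
  have ss: "s * s = 1" using \<sigma>(3) by (auto simp: abs_if split: if_splits)
  have "?I 0 \<sigma> \<le> 1 / \<nu>"
  proof (rule atom_osc_monotone_piece[OF l, of _ _ "- s"])
    fix t assume "t \<in> {0..\<sigma>}"
    hence "0 \<le> sin (\<sigma> - t)" using \<sigma> by (intro sin_ge_zero) auto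
    moreover have "sin (t - \<sigma>) = - sin (\<sigma> - t)" by (metis minus_diff_eq sin_minus)
    ultimately show "0 \<le> - s * sin (t - \<tau>)" unfolding \<sigma>(4) using ss by (simp add: mult.assoc[symmetric])
  qed (use \<sigma> in auto)
  moreover have "?I \<sigma> (\<sigma> + pi) \<le> 1 / \<nu>"
  proof (rule atom_osc_monotone_piece[OF l, of _ _ s])
    fix t assume "t \<in> {\<sigma>..\<sigma> + pi}"
    hence "0 \<le> sin (t - \<sigma>)" using \<sigma> by (intro sin_ge_zero) auto
    thus "0 \<le> s * sin (t - \<tau>)" unfolding \<sigma>(4) using ss by (simp add: mult.assoc[symmetric])
  qed (use \<sigma> in auto)
  moreover have "?I (\<sigma> + pi) (2 * pi) \<le> 1 / \<nu>"
  proof (rule atom_osc_monotone_piece[OF l, of _ _ "- s"])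
    fix t assume "t \<in> {\<sigma> + pi..2 * pi}"
    hence "0 \<le> sin (t - \<sigma> - pi)" using \<sigma> by (intro sin_ge_zero) auto
    moreover have "sin (t - \<sigma> - pi) = - sin (t - \<sigma>)" by (simp add: sin_diff[of "t - \<sigma>" pi])
    ultimately show "0 \<le> - s * sin (t - \<tau>)" unfolding \<sigma>(4) using ss by (simp add: mult.assoc[symmetric])
  qed (use \<sigma> in auto)
  moreover have "?I 0 \<sigma> + ?I \<sigma> (\<sigma> + pi) = ?I 0 (\<sigma> + pi)"
    using \<sigma> by (intro Henstock_Kurzweil_Integration.integral_combine atom_osc_integrable l) auto
  moreover have "?I 0 (\<sigma> + pi) + ?I (\<sigma> + pi) (2 * pi) = ?I 0 (2 * pi)"
    using \<sigma> by (intro Henstock_Kurzweil_Integration.integral_combine atom_osc_integrable l) auto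
  ultimately show ?thesis by (simp add: field_simps)
qed

lemma finite_circle_preimage:
  assumes "finite A"
  shows "finite {t \<in> {0..2*pi}. cis t \<in> A}"
proof -
  \<comment> \<open>The endpoint \<open>2 * pi\<close> is added separately because
    \<open>Arg2pi\<close> takes values below it.\<close>
  have "{t \<in> {0..2*pi}. cis t \<in> A} \<subseteq> insert (2*pi) (Arg2pi ` A)"
  proof
    fix t assume t: "t \<in> {t \<in> {0..2*pi}. cis t \<in> A}"
    have "Arg2pi (cis t) = t" if "t \<noteq> 2 * pi"
      using t that by (intro Arg2pi_unique[of 1]) (auto simp: cis_conv_exp)
    thus "t \<in> insert (2*pi) (Arg2pi ` A)" using t by force
  qed
  thus ?thesis using assms finite_subset by blast
qed

text \<open>Integration by parts moves the derivative from \<open>arctan q\<close>, which is bounded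
  by \<open>pi / 2\<close> however large \<open>q\<close> is, to \<open>X\<close>. The boundary
  terms cancel by periodicity, and each atom contributes at most \<open>3 / \<nu>\<close> to the
  variation, whence the bound \<open>N * (pi * \<nu>) * (3 / \<nu>)\<close>.\<close>

proposition phase_energy_bound:
  fixes q q' :: "real \<Rightarrow> real"
  assumes at: "\<And>j. j < N \<Longrightarrow> 0 < lam j \<and> norm (al j) = 1" and \<nu>: "0 < \<nu>"
    and q: "\<And>t. (q has_real_derivative q' t) (at t)" "continuous_on {0..2*pi} q'" "q (2*pi) = q 0"
  shows "integral {0..2*pi} (\<lambda>t. - (q' t) * rel_speed N lam al \<nu> (cis t) / (1 + (q t)\<^sup>2)) \<le> 3 * pi * real N"
proof -
  define X where "X t = rel_speed N lam al \<nu> (cis t)" for t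
  define \<tau> where "\<tau> j = Arg2pi (al j)" for j
  have al: "al j = cis (\<tau> j)" "0 \<le> \<tau> j" "\<tau> j < 2 * pi" if "j < N" for j
    using Arg2pi_eq[of "al j"] at[OF that] Arg2pi[of "al j"] by (auto simp: \<tau>_def cis_conv_exp)
  define S where "S = {t \<in> {0..2*pi}. cis t \<in> al ` {..<N}}"
  have finS: "finite S" unfolding S_def by (rule finite_circle_preimage) simp
  define D where "D j t = 2 - 2 * cos (t - \<tau> j)" for j t
  define \<omega> where "\<omega> t = (\<Sum>j<N. 2 * lam j / D j t)" for t
  define \<omega>' where "\<omega>' t = (\<Sum>j<N. - (2 * lam j * (2 * sin (t - \<tau> j)) / (D j t)\<^sup>2))" for t
  have speed: "atom_speed N lam al (cis t) = \<omega> t" for t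
    unfolding atom_speed_def \<omega>_def D_def
    by (intro sum.cong refl) (simp add: norm_cis_diff_power2 al(1))
  have Dpos: "0 < D j t" if "j < N" "cis t \<notin> al ` {..<N}" for j t
  proof -
    have "0 < (norm (cis t - cis (\<tau> j)))\<^sup>2" using that al(1)[OF that(1)] by (metis image_eqI lessThan_iff right_minus_eq zero_less_norm_iff zero_less_power)
    thus ?thesis unfolding norm_cis_diff_power2 D_def .
  qed
  have \<omega>nn: "0 \<le> \<omega> t" for t unfolding speed[symmetric] by (rule atom_speed_nonneg) (use at in auto)
  \<comment> \<open>The value at the finitely many atom angles is arbitrary; continuity of
    \<open>X\<close> suffices there for the fundamental theorem of calculus.\<close>
  define X' where "X' t = (if t \<in> S then 0 else 2 * \<nu> * \<omega>' t / (\<omega> t + \<nu>)\<^sup>2)" for t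
  have contX: "continuous_on UNIV X" unfolding X_def
    by (rule continuous_on_compose2[OF rel_speed_continuous continuous_on_cis[OF continuous_on_id]]) (use at \<nu> in auto)
  have dX: "(X has_real_derivative X' t) (at t)" if t: "t \<in> {0..2*pi} - S" for t
  proof -
    have nt: "cis t \<notin> al ` {..<N}" using t by (auto simp: S_def)
    have d\<omega>: "(\<omega> has_real_derivative \<omega>' t) (at t)"
      unfolding \<omega>_def \<omega>'_def
    proof (rule DERIV_sum)
      fix j assume "j \<in> {..<N}"
      hence "D j t \<noteq> 0" using Dpos[OF _ nt, of j] by auto
      moreover have "((\<lambda>t. D j t) has_real_derivative 2 * sin (t - \<tau> j)) (at t)"
        unfolding D_def by (auto intro!: derivative_eq_intros)
      ultimately show "((\<lambda>t. 2 * lam j / D j t) has_real_derivative - (2 * lam j * (2 * sin (t - \<tau> j)) / (D j t)\<^sup>2)) (at t)"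
        by (auto intro!: derivative_eq_intros simp: power2_eq_square)
    qed
    have "\<omega> t + \<nu> \<noteq> 0" using \<omega>nn[of t] \<nu> by simp
    hence "((\<lambda>t. (\<omega> t - \<nu>) / (\<omega> t + \<nu>)) has_real_derivative 2 * \<nu> * \<omega>' t / (\<omega> t + \<nu>)\<^sup>2) (at t)"
      by (auto intro!: derivative_eq_intros d\<omega> simp: power2_eq_square algebra_simps)
    moreover have "\<forall>\<^sub>F u in nhds t. X u = (\<omega> u - \<nu>) / (\<omega> u + \<nu>)"
    proof -
      have "open (cis -` (- al ` {..<N}))"
        by (intro open_vimage open_Compl finite_imp_closed continuous_on_cis continuous_on_id) auto
      hence "\<forall>\<^sub>F u in nhds t. u \<in> cis -` (- al ` {..<N})"
        using nt by (intro eventually_nhds_in_open) auto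
      thus ?thesis by eventually_elim (simp add: X_def rel_speed_def speed)
    qed
    ultimately show ?thesis using t by (subst DERIV_cong_ev[OF refl _ refl]) (auto simp: X'_def)
  qed
  define u where "u t = q' t * X t / (1 + (q t)\<^sup>2)" for t
  define v where "v t = arctan (q t) * X' t" for t
  have contq: "continuous_on A q" for A
    using q(1) by (intro continuous_at_imp_continuous_on ballI DERIV_isCont)
  have "((\<lambda>t. u t + v t) has_integral arctan (q (2*pi)) * X (2*pi) - arctan (q 0) * X 0) {0..2*pi}"
  proof (rule fundamental_theorem_of_calculus_strong[OF finS])
    show "continuous_on {0..2*pi} (\<lambda>t. arctan (q t) * X t)"
      by (intro continuous_intros contq continuous_on_subset[OF contX]) auto
    show "((\<lambda>t. arctan (q t) * X t) has_vector_derivative u t + v t) (at t)" if "t \<in> {0..2*pi} - S" for t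
      unfolding has_real_derivative_iff_has_vector_derivative[symmetric] u_def v_def
      by (rule derivative_eq_intros q(1) dX[OF that] refl)+ (simp add: field_simps)
  qed simp
  hence uv: "((\<lambda>t. u t + v t) has_integral 0) {0..2*pi}" by (simp add: q(3) X_def)
  have "1 + (q t)\<^sup>2 \<noteq> 0" for t using zero_le_power2[of "q t"] by linarith
  hence iu: "u integrable_on {0..2*pi}" unfolding u_def[abs_def]
    by (intro integrable_continuous_interval continuous_intros contq q(2) continuous_on_subset[OF contX]) auto
  from has_integral_diff[OF uv integrable_integral[OF iu]]
  have v: "(v has_integral - integral {0..2*pi} u) {0..2*pi}" by simp
  let ?M = "\<lambda>t. \<Sum>j<N. pi * \<nu> * \<bar>atom_osc \<nu> (lam j) (\<tau> j) t\<bar>"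
  have M: "(?M has_integral (\<Sum>j<N. pi * \<nu> * integral {0..2*pi} (\<lambda>t. \<bar>atom_osc \<nu> (lam j) (\<tau> j) t\<bar>))) {0..2*pi}"
    using at \<nu> by (intro has_integral_sum has_integral_mult_right integrable_integral atom_osc_integrable) auto
  have "v t \<le> ?M t" if "t \<in> {0..2*pi}" for t
  proof (cases "t \<in> S")
    case True
    thus ?thesis using \<nu> by (auto simp: v_def X'_def intro!: sum_nonneg)
  next
    case False
    hence nt: "cis t \<notin> al ` {..<N}" using that by (auto simp: S_def)
    \<comment> \<open>Dropping the other atoms from the denominator only enlarges the quotient;
      clearing \<open>D j t\<close> then leaves the oscillation of the single atom.\<close>
    have summand: "\<bar>2 * lam j * (2 * sin (t - \<tau> j)) / (D j t)\<^sup>2\<bar> / (\<omega> t + \<nu>)\<^sup>2 \<le> \<bar>atom_osc \<nu> (lam j) (\<tau> j) t\<bar>"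
      if j: "j < N" for j
    proof -
      note d = Dpos[OF j nt]
      have l: "0 < lam j" using at[OF j] by simp
      have "2 * lam j / D j t \<le> \<omega> t" unfolding \<omega>_def
        using at j Dpos[OF _ nt] by (intro member_le_sum divide_nonneg_nonneg) (auto intro: less_imp_le)
      hence "(2 * lam j / D j t + \<nu>)\<^sup>2 \<le> (\<omega> t + \<nu>)\<^sup>2"
        using l d \<nu> by (intro power_mono add_nonneg_nonneg divide_nonneg_nonneg) auto
      moreover have "0 < 2 * lam j / D j t + \<nu>" using l d \<nu> by (intro add_pos_pos divide_pos_pos) auto
      ultimately have "\<bar>2 * lam j * (2 * sin (t - \<tau> j)) / (D j t)\<^sup>2\<bar> / (\<omega> t + \<nu>)\<^sup>2
          \<le> \<bar>2 * lam j * (2 * sin (t - \<tau> j)) / (D j t)\<^sup>2\<bar> / (2 * lam j / D j t + \<nu>)\<^sup>2"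
        by (intro divide_left_mono mult_pos_pos) (auto intro: less_le_trans[OF zero_less_power])
      also have "\<dots> = \<bar>2 * lam j * (2 * sin (t - \<tau> j))\<bar> / (2 * lam j + \<nu> * D j t)\<^sup>2"
      proof -
        have "(D j t)\<^sup>2 * (2 * lam j / D j t + \<nu>)\<^sup>2 = (2 * lam j + \<nu> * D j t)\<^sup>2"
          using d by (simp add: power_mult_distrib[symmetric] distrib_left mult.commute)
        thus ?thesis by (simp add: abs_divide)
      qed
      also have "\<dots> = \<bar>atom_osc \<nu> (lam j) (\<tau> j) t\<bar>" by (simp add: atom_osc_def D_def abs_divide)
      finally show ?thesis .
    qed
    have "\<bar>v t\<bar> = \<bar>arctan (q t)\<bar> * (2 * \<nu> * (\<bar>\<omega>' t\<bar> / (\<omega> t + \<nu>)\<^sup>2))"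
      using False \<nu> by (simp add: v_def X'_def abs_mult abs_divide)
    also have "\<dots> \<le> (pi / 2) * (2 * \<nu> * (\<Sum>j<N. \<bar>atom_osc \<nu> (lam j) (\<tau> j) t\<bar>))"
    proof (intro mult_mono)
      show "\<bar>arctan (q t)\<bar> \<le> pi / 2" using arctan_bounded[of "q t"] by linarith
      have "\<bar>\<omega>' t\<bar> / (\<omega> t + \<nu>)\<^sup>2 \<le> (\<Sum>j<N. \<bar>2 * lam j * (2 * sin (t - \<tau> j)) / (D j t)\<^sup>2\<bar>) / (\<omega> t + \<nu>)\<^sup>2"
        unfolding \<omega>'_def by (intro divide_right_mono order_trans[OF sum_abs]) (auto simp: abs_minus_cancel)
      also have "\<dots> \<le> (\<Sum>j<N. \<bar>atom_osc \<nu> (lam j) (\<tau> j) t\<bar>)"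
        unfolding sum_divide_distrib by (intro sum_mono summand) auto
      finally show "\<bar>\<omega>' t\<bar> / (\<omega> t + \<nu>)\<^sup>2 \<le> (\<Sum>j<N. \<bar>atom_osc \<nu> (lam j) (\<tau> j) t\<bar>)" .
    qed (use \<nu> in auto)
    also have "\<dots> = ?M t" by (simp add: sum_distrib_left mult.assoc)
    finally show ?thesis by simp
  qed
  from has_integral_le[OF v M this]
  have "- integral {0..2*pi} u \<le> (\<Sum>j<N. pi * \<nu> * integral {0..2*pi} (\<lambda>t. \<bar>atom_osc \<nu> (lam j) (\<tau> j) t\<bar>))" .
  also have "\<dots> \<le> (\<Sum>j<N. pi * \<nu> * (3 / \<nu>))"
    using at \<nu> al by (intro sum_mono mult_left_mono atom_osc_total) auto
  also have "\<dots> = 3 * pi * real N" using \<nu> by simp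
  finally have "integral {0..2*pi} (\<lambda>t. - u t) \<le> 3 * pi * real N" by simp
  thus ?thesis by (simp add: u_def[abs_def] X_def)
qed

subsection \<open>Counting the atoms\<close>

lemma Re_herglotz_nonneg:
  assumes "norm a = 1" "norm z < 1"
  shows "0 \<le> Re (herglotz a z)"
proof -
  define u where "u = a * z"
  have u: "norm u < 1" using assms by (simp add: u_def norm_mult)
  have "(norm u)\<^sup>2 \<le> 1" using u by (simp add: power_le_one)
  hence "(Re u)\<^sup>2 + (Im u)\<^sup>2 \<le> 1" unfolding cmod_power2 .
  hence "0 \<le> Re (1 + u) * Re (1 - u) + Im (1 + u) * Im (1 - u)"
    by (simp add: power2_eq_square algebra_simps)
  thus ?thesis unfolding herglotz_def u_def[symmetric] Re_divide
    by (intro divide_nonneg_nonneg) auto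
qed

lemma herglotz_holomorphic:
  assumes "norm a = 1"
  shows "herglotz a holomorphic_on ball 0 1"
proof -
  have "1 - a * z \<noteq> 0" if "z \<in> ball 0 1" for z
  proof
    assume "1 - a * z = 0"
    hence "norm (a * z) = 1" by (metis eq_iff_diff_eq_0 norm_one)
    thus False using that assms by (simp add: norm_mult)
  qed
  thus ?thesis unfolding herglotz_def[abs_def] by (intro holomorphic_intros) auto
qed

section \<open>Consequences of extremality for one atomic representation\<close>

locale extremal_atoms =
  fixes n :: nat and f :: "complex \<Rightarrow> complex" and N :: nat and \<gamma> :: complex
    and lam :: "nat \<Rightarrow> real" and al :: "nat \<Rightarrow> complex"
  assumes n: "1 \<le> n" and ext: "extremal n f" and rep: "atom_repr f N \<gamma> lam al"
begin

definition "F = fps_expansion f 0"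
definition "Q t = var_poly n (fps_nth F) (cis t)"
definition "Q' t = var_poly' n (fps_nth F) (cis t)"

lemma atoms: "j < N \<Longrightarrow> 0 < lam j" "j < N \<Longrightarrow> norm (al j) = 1"
  using rep by (auto simp: atom_repr_def)

lemma f_B0: "f \<in> B0" using ext by (simp add: extremal_def)

lemma F: "f has_fps_expansion F" unfolding F_def using f_B0 by (rule B0_expansion)

definition "p z = (\<Sum>j<N. of_real (lam j) * herglotz (al j) z)"

lemma f_eq: "z \<in> ball 0 1 \<Longrightarrow> f z = \<gamma> * exp (- p z)"
  using rep by (simp add: atom_repr_def p_def herglotz_def)

lemma p_holomorphic: "p holomorphic_on ball 0 1"
  unfolding p_def by (intro holomorphic_intros herglotz_holomorphic atoms) auto

lemma coeff_eq: "fps_nth F k = (deriv ^^ k) f 0 / fact k"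
  by (rule fps_nth_fps_expansion[OF F])

text \<open>Mass may be added at any point of the circle: the Herglotz kernel has non-negative real
  part, so the varied function stays in \<open>B0\<close>.\<close>

lemma Re_Q_nonneg: "0 \<le> Re (Q t)"
proof -
  have "0 \<le> Re (fps_nth (F * herglotz_fps (cis t)) n)"
  proof (rule first_variation[OF ext F herglotz_holomorphic herglotz_expansion zero_less_one])
    fix s :: real assume s: "0 < s" "s < 1"
    have "norm (f z * exp (- of_real s * herglotz (cis t) z)) \<le> 1" if z: "z \<in> ball 0 1" for z
    proof -
      have "0 \<le> s * Re (herglotz (cis t) z)" using s z by (intro mult_nonneg_nonneg Re_herglotz_nonneg) auto
      hence "norm (exp (- of_real s * herglotz (cis t) z)) \<le> 1" by simp
      thus ?thesis using f_B0 z unfolding norm_mult by (intro mult_le_one) (auto simp: B0_def)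
    qed
    thus "(\<lambda>z. f z * exp (- of_real s * herglotz (cis t) z)) \<in> B0"
      using f_B0 by (auto simp: B0_def intro!: holomorphic_intros herglotz_holomorphic)
  qed simp
  thus ?thesis by (simp add: Q_def var_poly_fps)
qed

text \<open>At an atom mass can also be removed, up to \<open>lam j\<close>, which gives the
  inequality opposite to \<open>Re_Q_nonneg\<close>.\<close>

lemma Re_var_poly_atom:
  assumes j: "j < N"
  shows "Re (var_poly n (fps_nth F) (al j)) = 0"
proof -
  have "0 \<le> Re (fps_nth (F * (- herglotz_fps (al j))) n)"
  proof (rule first_variation[OF ext F, where h = "\<lambda>z. - herglotz (al j) z" and \<delta> = "lam j"])
    show "(\<lambda>z. - herglotz (al j) z) holomorphic_on ball 0 1"
      by (intro holomorphic_intros herglotz_holomorphic atoms j)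
    show "(\<lambda>z. - herglotz (al j) z) has_fps_expansion - herglotz_fps (al j)"
      by (intro fps_expansion_intros herglotz_expansion)
    fix s :: real assume s: "0 < s" "s < lam j"
    have "norm (f z * exp (- of_real s * - herglotz (al j) z)) \<le> 1" if z: "z \<in> ball 0 1" for z
    proof -
      have nn: "0 \<le> Re (herglotz (al i) z)" if "i < N" for i
        using z atoms(2)[OF that] by (intro Re_herglotz_nonneg) auto
      have "s * Re (herglotz (al j) z) \<le> lam j * Re (herglotz (al j) z)"
        using s nn[OF j] by (intro mult_right_mono) auto
      also have "\<dots> \<le> (\<Sum>i<N. lam i * Re (herglotz (al i) z))"
        using j nn atoms by (intro member_le_sum mult_nonneg_nonneg) (auto intro: less_imp_le)
      also have "\<dots> = Re (p z)" by (simp add: p_def)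
      finally have le: "s * Re (herglotz (al j) z) \<le> Re (p z)" .
      have "norm \<gamma> = 1" using rep by (simp add: atom_repr_def)
      hence "norm (f z * exp (- of_real s * - herglotz (al j) z)) = exp (- Re (p z)) * exp (s * Re (herglotz (al j) z))"
        using f_eq[OF z] by (simp add: norm_mult)
      also have "\<dots> = exp (s * Re (herglotz (al j) z) - Re (p z))" by (simp add: exp_diff exp_minus field_simps)
      finally show ?thesis using le by simp
    qed
    thus "(\<lambda>z. f z * exp (- of_real s * - herglotz (al j) z)) \<in> B0"
      using f_B0 by (auto simp: B0_def intro!: holomorphic_intros herglotz_holomorphic atoms j)
  qed (use atoms j in auto)
  hence "Re (var_poly n (fps_nth F) (al j)) \<le> 0" by (simp add: var_poly_fps)
  moreover have "al j = cis (Arg (al j))" using atoms(2)[OF j] cis_Arg[of "al j"] by (force simp: sgn_div_norm)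
  ultimately show ?thesis using Re_Q_nonneg[of "Arg (al j)"] by (simp add: Q_def)
qed

text \<open>Differentiation along the circle brings in a factor \<open>\<i>\<close>, which exchanges
  the real and imaginary parts of \<open>Q'\<close>.\<close>

lemma Q_deriv:
  "((\<lambda>t. Re (Q t)) has_real_derivative - Im (Q' t)) (at t)"
  "((\<lambda>t. Im (Q t)) has_real_derivative Re (Q' t)) (at t)"
  using var_poly_has_vector_derivative[of n "fps_nth F" t]
  unfolding Q_def Q'_def has_vector_derivative_complex_iff by (auto simp: has_real_derivative_iff_has_vector_derivative)

text \<open>The non-negative function \<open>Re (Q t)\<close> has a minimum at an atom, so its
  derivative vanishes there.\<close>

lemma Im_var_poly'_atom:
  assumes j: "j < N"
  shows "Im (var_poly' n (fps_nth F) (al j)) = 0"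
proof -
  have al: "al j = cis (Arg (al j))" using atoms(2)[OF j] cis_Arg[of "al j"] by (force simp: sgn_div_norm)
  have "Re (Q (Arg (al j))) = 0" using Re_var_poly_atom[OF j] al by (simp add: Q_def)
  hence "- Im (Q' (Arg (al j))) = 0"
    using Re_Q_nonneg by (intro DERIV_local_min[OF Q_deriv(1) zero_less_one]) auto
  thus ?thesis using al by (simp add: Q'_def)
qed

lemma ode: "fps_deriv F = - F * fps_deriv (\<Sum>j<N. fps_const (of_real (lam j)) * herglotz_fps (al j))"
proof -
  let ?P = "\<Sum>j<N. fps_const (of_real (lam j)) * herglotz_fps (al j)"
  have P: "p has_fps_expansion ?P" unfolding p_def[abs_def]
    by (intro fps_expansion_intros herglotz_expansion)
  have e1: "deriv f has_fps_expansion fps_deriv F" by (intro fps_expansion_intros F)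
  have e2: "(\<lambda>z. - f z * deriv p z) has_fps_expansion - F * fps_deriv ?P"
    by (intro fps_expansion_intros F P)
  have "deriv f z = - f z * deriv p z" if z: "z \<in> ball 0 1" for z
  proof -
    have "(p has_field_derivative deriv p z) (at z)"
      using p_holomorphic z by (intro holomorphic_derivI[of p "ball 0 1"]) auto
    hence "((\<lambda>z. \<gamma> * exp (- p z)) has_field_derivative - f z * deriv p z) (at z)"
      by (auto intro!: derivative_eq_intros simp: f_eq[OF z])
    hence "(f has_field_derivative - f z * deriv p z) (at z)"
      by (rule has_field_derivative_transform_within_open[OF _ open_ball z]) (simp add: f_eq)
    thus ?thesis by (rule DERIV_imp_deriv)
  qed
  hence "eventually (\<lambda>z. - f z * deriv p z = deriv f z) (nhds 0)"
    using eventually_nhds_in_open[of "ball 0 1" "0::complex"] by (auto elim!: eventually_mono)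
  from has_fps_expansion_cong[OF this refl] e2 have "deriv f has_fps_expansion - F * fps_deriv ?P" by blast
  with e1 show ?thesis by (rule fps_expansion_unique_complex)
qed

lemma phase_speed:
  assumes "cis t \<notin> al ` {..<N}"
  shows "Re (Q' t) = (real n - atom_speed N lam al (cis t)) * Re (Q t)"
  unfolding Q_def Q'_def
  by (rule speed_identity[OF ode _ _ _ _ assms]) (auto simp: atoms Re_var_poly_atom Im_var_poly'_atom)

lemma Q_continuous: "continuous_on A Q" "continuous_on A Q'"
  unfolding Q_def[abs_def] Q'_def[abs_def] var_poly_def var_poly'_def
  by (intro continuous_intros)+

text \<open>The mean is the value of \<open>var_poly\<close> at 0, that is \<open>2 * a - a\<close>
  for the \<open>n\<close>-th coefficient \<open>a\<close>, whose real part is at least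
  \<open>1 / 2\<close>.\<close>

lemma Re_Q_mean: "pi \<le> integral {0..2*pi} (\<lambda>t. Re (Q t))"
proof -
  have "((\<lambda>t. var_poly n (fps_nth F) (of_real 1 * cis t)) has_integral 2 * of_real pi * var_poly n (fps_nth F) 0) {0..2*pi}"
    unfolding var_poly_def by (rule circle_mean) (intro holomorphic_intros, simp)
  also have "var_poly n (fps_nth F) 0 = fps_nth F n"
    by (simp add: var_poly_def power_0_left if_distrib cong: if_cong)
  finally have "(Q has_integral 2 * of_real pi * fps_nth F n) {0..2*pi}" by (simp add: Q_def[abs_def])
  from has_integral_linear[OF this bounded_linear_Re]
  have "((\<lambda>t. Re (Q t)) has_integral 2 * pi * Re (fps_nth F n)) {0..2*pi}" by (simp add: o_def)
  hence "integral {0..2*pi} (\<lambda>t. Re (Q t)) = 2 * pi * Re (fps_nth F n)" by (rule integral_unique)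
  moreover have "2 * pi * (1 / 2) \<le> 2 * pi * Re (fps_nth F n)"
    using extremal_coeff_ge_half[OF ext n F] by (intro mult_left_mono) auto
  ultimately show ?thesis by simp
qed

text \<open>By Parseval's identity: the coefficients of \<open>Q\<close> are at most twice those of
  \<open>f\<close> in modulus, and the squares of the latter sum to at most 1.\<close>

lemma Q_square_mean: "integral {0..2*pi} (\<lambda>t. (norm (Q t))\<^sup>2) \<le> 8 * pi"
proof -
  let ?a = "fps_nth F"
  define c where "c k = (if k = 0 then ?a n else 2 * ?a (n - k))" for k
  have "Q t = (\<Sum>k\<le>n. c k * cis t ^ k)" for t
  proof -
    have "(\<Sum>k\<le>n. c k * cis t ^ k) = (\<Sum>k\<le>n. 2 * (?a (n - k) * cis t ^ k) - (if k = 0 then ?a n else 0))"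
      by (intro sum.cong) (auto simp: c_def)
    thus ?thesis by (simp add: Q_def var_poly_def sum_subtractf sum_distrib_left)
  qed
  hence "((\<lambda>t. (norm (Q t))\<^sup>2) has_integral 2 * pi * (\<Sum>k\<le>n. (norm (c k))\<^sup>2)) {0..2*pi}"
    using parseval_trig[of c n] by simp
  hence "integral {0..2*pi} (\<lambda>t. (norm (Q t))\<^sup>2) = 2 * pi * (\<Sum>k\<le>n. (norm (c k))\<^sup>2)" by (rule integral_unique)
  also have "(\<Sum>k\<le>n. (norm (c k))\<^sup>2) \<le> (\<Sum>k\<le>n. 4 * (norm (?a (n - k)))\<^sup>2)"
    by (intro sum_mono) (auto simp: c_def norm_mult power_mult_distrib)
  also have "\<dots> = 4 * (\<Sum>k\<le>n. (norm (?a k))\<^sup>2)"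
    using sum.nat_diff_reindex[of "\<lambda>k. (norm (?a k))\<^sup>2" "Suc n"]
    by (simp add: sum_distrib_left[symmetric] lessThan_Suc_atMost)
  also have "(\<Sum>k\<le>n. (norm (?a k))\<^sup>2) \<le> 1"
    unfolding coeff_eq using f_B0 by (intro coeff_square_sum_le_1) (auto simp: B0_def)
  finally show ?thesis by simp
qed


text \<open>Off the atoms \<open>T\<close> is dominated by \<open>r\<close>, whose integral is a
  fixed fraction of pi plus a multiple of \<open>N / n\<close>; the lower bound pi for the integral
  of \<open>T\<close> then forces \<open>N / n\<close> up.\<close>

lemma atom_count_bound:
  fixes \<epsilon> :: real
  assumes \<epsilon>: "0 < \<epsilon>" "\<epsilon> \<le> 1 / 4"
    and level: "integral {0..2*pi} (\<lambda>t. max 0 (1 - \<bar>rel_speed N lam al (real n) (cis t)\<bar> / \<epsilon>)) \<le> 2 * pi * (1 / 400)"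
  shows "\<epsilon>\<^sup>2 / 12030 * real n \<le> real N"
proof -
  define T q X b g where "T t = Re (Q t)" and "q t = Im (Q t)"
    and "X t = rel_speed N lam al (real n) (cis t)"
    and "b t = max 0 (1 - \<bar>X t\<bar> / \<epsilon>)"
    and "g t = - (Re (Q' t)) * X t / (1 + (q t)\<^sup>2)" for t
  \<comment> \<open>\<open>1604 = 4 * 401\<close>, where 4 comes from the threshold
    \<open>\<epsilon> / 2\<close> for \<open>X\<close> and \<open>401 = 1 + 20\<^sup>2\<close> from
    the threshold 20 for \<open>q\<close>.\<close>
  define K where "K = 1604 / (real n * \<epsilon>\<^sup>2)"
  define S where "S = {t \<in> {0..2*pi}. cis t \<in> al ` {..<N}}"
  \<comment> \<open>The first two summands handle points where the speed is near \<open>n\<close>,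
    the third those with large \<open>q\<close>, and the last one all others.\<close>
  define r where "r t = (norm (Q t))\<^sup>2 / 40 + 40 * b t + (norm (Q t))\<^sup>2 / 40 + K * g t" for t
  have n0: "0 < real n" using n by simp
  have K: "0 < K" using n0 \<epsilon> by (simp add: K_def)
  have cX: "continuous_on {0..2*pi} X" unfolding X_def
    by (rule continuous_on_compose2[OF rel_speed_continuous continuous_on_cis[OF continuous_on_id]])
       (use atoms n0 in auto)
  have q1: "1 + (q t)\<^sup>2 \<noteq> 0" for t using zero_le_power2[of "q t"] by linarith
  have cb: "continuous_on {0..2*pi} b" unfolding b_def by (intro continuous_intros cX) (use \<epsilon> in auto)
  have cQ: "continuous_on {0..2*pi} (\<lambda>t. (norm (Q t))\<^sup>2 / 40)" by (intro continuous_intros Q_continuous) auto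
  have cg: "continuous_on {0..2*pi} g" unfolding g_def q_def
    by (intro continuous_intros cX Q_continuous) (use q1 in \<open>auto simp: q_def\<close>)
  have ib: "integral {0..2*pi} b \<le> 2 * pi * (1 / 400)" using level by (simp add: b_def[abs_def] X_def)
  have ig: "integral {0..2*pi} g \<le> 3 * pi * real N"
    unfolding g_def[abs_def] X_def q_def
  proof (rule phase_energy_bound[OF _ n0 Q_deriv(2)])
    show "continuous_on {0..2*pi} (\<lambda>t. Re (Q' t))" by (intro continuous_intros Q_continuous)
    show "Im (Q (2 * pi)) = Im (Q 0)" by (simp add: Q_def)
  qed (use atoms in auto)
  have iQ: "integral {0..2*pi} (\<lambda>t. (norm (Q t))\<^sup>2 / 40) \<le> pi / 5"
    using Q_square_mean by simp
  have mean: "pi \<le> integral {0..2*pi} T" unfolding T_def[abs_def] by (rule Re_Q_mean)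
  have r: "(r has_integral integral {0..2*pi} (\<lambda>t. (norm (Q t))\<^sup>2 / 40) + 40 * integral {0..2*pi} b
      + integral {0..2*pi} (\<lambda>t. (norm (Q t))\<^sup>2 / 40) + K * integral {0..2*pi} g) {0..2*pi}"
    unfolding r_def[abs_def]
    by (intro has_integral_add has_integral_mult_right integrable_integral integrable_continuous_interval cb cQ cg)
  have T_le: "T t \<le> r t" if t: "t \<in> {0..2*pi} - S" for t
  proof -
    define w where "w = atom_speed N lam al (cis t)"
    have nt: "cis t \<notin> al ` {..<N}" using t by (auto simp: S_def)
    have w: "0 \<le> w" unfolding w_def by (rule atom_speed_nonneg) (rule atoms)
    have T0: "0 \<le> T t" unfolding T_def by (rule Re_Q_nonneg)
    have b01: "0 \<le> b t" "b t \<le> 1" using \<epsilon> by (auto simp: b_def)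
    have X: "X t = (w - real n) / (w + real n)" using nt by (simp add: X_def rel_speed_def w_def)
    \<comment> \<open>\<open>phase_speed\<close> gives \<open>- Re (Q' t) = T t * (w - n)\<close>,
      and \<open>w - n = X t * (w + n)\<close>; the square shows that the integrand has a
      sign.\<close>
    have g: "g t = T t * (X t)\<^sup>2 * (w + real n) / (1 + (q t)\<^sup>2)"
    proof -
      have nz: "w + real n \<noteq> 0" using w n0 by linarith
      have "(X t)\<^sup>2 * (w + real n) = X t * (X t * (w + real n))" by (simp only: power2_eq_square mult.assoc)
      also have "X t * (w + real n) = w - real n" unfolding X using nz by simp
      finally have Xs: "(X t)\<^sup>2 * (w + real n) = X t * (w - real n)" .
      have "- ((real n - w) * T t) * X t = T t * (X t * (w - real n))" by algebra
      thus ?thesis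
        unfolding g_def phase_speed[OF nt] w_def[symmetric] T_def[symmetric] mult.assoc[of "T t"] Xs by simp
    qed
    have g0: "0 \<le> g t" unfolding g using T0 w by (intro divide_nonneg_nonneg mult_nonneg_nonneg) auto
    have nQ: "(norm (Q t))\<^sup>2 = (T t)\<^sup>2 + (q t)\<^sup>2" by (simp add: cmod_power2 T_def q_def)
    have parts: "0 \<le> (norm (Q t))\<^sup>2 / 40" "0 \<le> 40 * b t" "0 \<le> K * g t" using b01 g0 K by auto
    consider "1 / 2 \<le> b t" | "20 < \<bar>q t\<bar>" | "b t < 1 / 2" "\<bar>q t\<bar> \<le> 20" by linarith
    thus ?thesis
    proof cases
      case 1
      have "T t \<le> 2 * b t * T t" using 1 T0 mult_right_mono[of 1 "2 * b t" "T t"] by simp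
      also have "\<dots> \<le> (T t)\<^sup>2 / 40 + 40 * (b t)\<^sup>2"
        using zero_le_power2[of "T t - 40 * b t"] by (simp add: power2_eq_square algebra_simps)
      also have "\<dots> \<le> (norm (Q t))\<^sup>2 / 40 + 40 * b t"
        unfolding nQ using b01 mult_left_mono[of "b t" 1 "b t"] by (intro add_mono) (auto simp: power2_eq_square)
      finally show ?thesis using parts unfolding r_def by linarith
    next
      case 2
      have "T t * 20 \<le> T t * \<bar>q t\<bar>" using 2 T0 by (intro mult_left_mono) auto
      also have "\<dots> \<le> (norm (Q t))\<^sup>2 / 2" unfolding nQ
        using zero_le_power2[of "T t - \<bar>q t\<bar>"] by (simp add: power2_eq_square algebra_simps)
      finally show ?thesis using parts unfolding r_def by linarith
    next
      case 3
      have "\<epsilon> / 2 \<le> \<bar>X t\<bar>" using 3(1) \<epsilon> by (auto simp: b_def field_simps max_def split: if_splits)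
      hence "(\<epsilon> / 2)\<^sup>2 \<le> (X t)\<^sup>2" using \<epsilon> by (metis abs_le_square_iff abs_of_nonneg half_gt_zero less_imp_le)
      hence "(\<epsilon> / 2)\<^sup>2 * real n \<le> (X t)\<^sup>2 * (w + real n)" using w by (intro mult_mono) auto
      hence num: "T t * ((\<epsilon> / 2)\<^sup>2 * real n) \<le> T t * ((X t)\<^sup>2 * (w + real n))" using T0 by (rule mult_left_mono)
      have "(q t)\<^sup>2 \<le> 20\<^sup>2" using 3(2) by (metis abs_le_square_iff abs_numeral)
      hence den: "1 + (q t)\<^sup>2 \<le> 401" by simp
      have "T t * ((\<epsilon> / 2)\<^sup>2 * real n) / 401 \<le> T t * ((X t)\<^sup>2 * (w + real n)) / (1 + (q t)\<^sup>2)"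
        using num den T0 w by (intro frac_le mult_nonneg_nonneg) (auto intro: add_pos_nonneg)
      also have "\<dots> = g t" by (simp add: g mult_ac)
      finally have "K * (T t * ((\<epsilon> / 2)\<^sup>2 * real n) / 401) \<le> K * g t" using K by (intro mult_left_mono) auto
      moreover have "K * (T t * ((\<epsilon> / 2)\<^sup>2 * real n) / 401) = T t"
        using n0 \<epsilon> by (simp add: K_def power2_eq_square field_simps)
      ultimately show ?thesis using parts unfolding r_def by linarith
    qed
  qed
  have "finite S" unfolding S_def by (rule finite_circle_preimage) simp
  \<comment> \<open>The comparison is proved only off the atoms; changing \<open>r\<close> on a
    finite set does not affect its integral.\<close>
  have 1: "((\<lambda>t. if t \<in> S then T t else r t) has_integral integral {0..2*pi} (\<lambda>t. (norm (Q t))\<^sup>2 / 40) + 40 * integral {0..2*pi} b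
      + integral {0..2*pi} (\<lambda>t. (norm (Q t))\<^sup>2 / 40) + K * integral {0..2*pi} g) {0..2*pi}"
    by (rule has_integral_spike_finite[OF \<open>finite S\<close> _ r]) simp
  have "continuous_on {0..2*pi} T" unfolding T_def by (intro continuous_intros Q_continuous)
  hence 2: "(T has_integral integral {0..2*pi} T) {0..2*pi}"
    by (rule integrable_integral[OF integrable_continuous_interval])
  have "integral {0..2*pi} T \<le> integral {0..2*pi} (\<lambda>t. (norm (Q t))\<^sup>2 / 40) + 40 * integral {0..2*pi} b
      + integral {0..2*pi} (\<lambda>t. (norm (Q t))\<^sup>2 / 40) + K * integral {0..2*pi} g"
    by (rule has_integral_le[OF 2 1]) (simp add: T_le)
  moreover have "K * integral {0..2*pi} g \<le> K * (3 * pi * real N)" using ig K by (intro mult_left_mono) auto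
  \<comment> \<open>Each of the first three summands costs at most \<open>pi / 5\<close>, leaving
    \<open>2 * pi / 5\<close> to be paid by the atoms;
    \<open>12030 = 3 * 1604 * 5 / 2\<close>.\<close>
  ultimately have "pi \<le> pi / 5 + 40 * (2 * pi * (1 / 400)) + pi / 5 + K * (3 * pi * real N)"
    using mean ib iQ by linarith
  moreover have "K * (3 * pi * real N) = pi * (3 * K * real N)" by (simp only: mult_ac)
  ultimately have "pi * (2 / 5) \<le> pi * (3 * K * real N)" by linarith
  hence "2 / 5 \<le> 3 * K * real N" by (rule mult_left_le_imp_le) simp
  hence "2 / 5 * (real n * \<epsilon>\<^sup>2) \<le> 4812 * real N" using n0 \<epsilon> by (simp add: K_def field_simps)
  thus ?thesis by (simp add: mult.commute)
qed

end

theorem theorem1: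
  shows "\<exists>c::real>0. \<forall>n::nat. \<forall>f N \<gamma> lam al.
           1 \<le> n \<longrightarrow> extremal n f \<longrightarrow> atom_repr f N \<gamma> lam al \<longrightarrow> c * real n \<le> real N"
proof -
  \<comment> \<open>With this level \<open>40 * (2 * pi / 400)\<close> is the share
    \<open>pi / 5\<close> allotted to the points of nearly constant speed.\<close>
  have "0 < (1 / 400 :: real)" by simp
  then obtain \<epsilon> :: real where \<epsilon>: "0 < \<epsilon>" "\<epsilon> \<le> 1 / 4"
    "\<forall>N lam al \<nu>. (\<forall>j<N. 0 < lam j \<and> norm (al j) = 1) \<longrightarrow> 0 < \<nu> \<longrightarrow>
       integral {0..2*pi} (\<lambda>t. max 0 (1 - \<bar>rel_speed N lam al \<nu> (cis t)\<bar> / \<epsilon>)) \<le> 2 * pi * (1 / 400)"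
    by (rule mean_near_level) (rule that)
  show ?thesis
  proof (intro exI[of _ "\<epsilon>\<^sup>2 / 12030"] conjI allI impI)
    show "0 < \<epsilon>\<^sup>2 / 12030" using \<epsilon>(1) by simp
    fix n f N \<gamma> lam al
    assume "1 \<le> n" "extremal n f" "atom_repr f N \<gamma> lam al"
    then interpret extremal_atoms n f N \<gamma> lam al by unfold_locales
    show "\<epsilon>\<^sup>2 / 12030 * real n \<le> real N"
    proof (rule atom_count_bound[OF \<epsilon>(1,2) \<epsilon>(3)[rule_format]])
      show "0 < lam j \<and> norm (al j) = 1" if "j < N" for j using atoms[OF that] by simp
      show "0 < real n" using n by simp
    qed
  qed
qed

end
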